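(* Let $E$ be an atomic KB-space (a Banach lattice), let $Y$ be a Banach space, and let $T:E\to Y$ be an unbounded continuous operator. Then the following assertions are equivalent: (1) $T$ is uaw-Dunford-Pettis. (2) $T$ carries relatively $\sigma$-uaw-compact subsets of $E$ into norm totally bounded subsets of $Y$. (3) For every Banach lattice $G$ and every operator $S:G\to E$, the composition $T\circ S$ is compact. (4) For every operator $S:\ell^1\to E$, the composition $T\circ S$ is compact.
   Context: "Operator" means bounded linear map. A sequence $(x_n)$ in a Banach lattice $E$ is uaw-convergent (unbounded absolutely weakly convergent) to $x\in E$, written $x_n\overset{uaw}{\longrightarrow}x$, if $|x_n-x|\wedge u\to 0$ weakly for every $u\in E^+$. An operator $T:E\to Y$ from a Banach lattice $E$ to a Banach space $Y$ is uaw-Dunford-Pettis if for every norm bounded sequence $(x_n)$ in $E$, $x_n\overset{uaw}{\longrightarrow}0$ implies $\|Tx_n\|\to 0$. It is unbounded continuous if for every norm bounded sequence $(x_n)$ in $E$ with $x_n\overset{uaw}{\longrightarrow}0$, the sequence $(Tx_n)$ is weakly null. A norm bounded subset $A$ of $E$ is relatively $\sigma$-uaw-compact if every sequence in $A$ has a subsequence that is uaw-convergent in $E$. A KB-space is a Banach lattice in which every norm bounded increasing sequence of positive elements is norm convergent. *)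

theory Defs
  imports "HOL-Analysis.Analysis" "HOL-Library.Lattice_Algebras"
begin

section \<open>Banach lattices as types\<close>

class banach_lattice = banach + ordered_real_vector + lattice_ab_group_add_abs +
  assumes norm_mono_abs: "\<bar>x\<bar> \<le> \<bar>y\<bar> \<Longrightarrow> norm x \<le> norm y"

class kb_space = banach_lattice +
  assumes bounded_incseq_convergent:
    "(\<And>n. 0 \<le> x n) \<Longrightarrow> (\<And>n. x n \<le> x (Suc n)) \<Longrightarrow> bounded (range x) \<Longrightarrow> convergent x"

definition (in banach_lattice) atom :: "'a \<Rightarrow> bool" where
  "atom a \<longleftrightarrow> 0 < a \<and> (\<forall>x. 0 \<le> x \<and> x \<le> a \<longrightarrow> (\<exists>c. x = c *\<^sub>R a))"

class atomic_banach_lattice = banach_lattice +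
  assumes atom_below: "0 < x \<Longrightarrow> \<exists>a. atom a \<and> a \<le> x"

definition weakly_tendsto :: "(nat \<Rightarrow> 'a::real_normed_vector) \<Rightarrow> 'a \<Rightarrow> bool" where
  "weakly_tendsto x l \<longleftrightarrow>
     (\<forall>f :: 'a \<Rightarrow> real. bounded_linear f \<longrightarrow> (\<lambda>n. f (x n)) \<longlonglongrightarrow> f l)"

definition uaw_tendsto :: "(nat \<Rightarrow> 'e::banach_lattice) \<Rightarrow> 'e \<Rightarrow> bool" where
  "uaw_tendsto x l \<longleftrightarrow> (\<forall>u\<ge>0. weakly_tendsto (\<lambda>n. inf \<bar>x n - l\<bar> u) 0)"

definition uaw_Dunford_Pettis :: "('e::banach_lattice \<Rightarrow> 'y::real_normed_vector) \<Rightarrow> bool" where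
  "uaw_Dunford_Pettis T \<longleftrightarrow>
     (\<forall>x. bounded (range x) \<and> uaw_tendsto x 0 \<longrightarrow> (\<lambda>n. norm (T (x n))) \<longlonglongrightarrow> 0)"

definition unbounded_continuous :: "('e::banach_lattice \<Rightarrow> 'y::real_normed_vector) \<Rightarrow> bool" where
  "unbounded_continuous T \<longleftrightarrow>
     (\<forall>x. bounded (range x) \<and> uaw_tendsto x 0 \<longrightarrow> weakly_tendsto (\<lambda>n. T (x n)) 0)"

definition relatively_sigma_uaw_compact :: "'e::banach_lattice set \<Rightarrow> bool" where
  "relatively_sigma_uaw_compact A \<longleftrightarrow>
     bounded A \<and>
     (\<forall>x. (\<forall>n::nat. x n \<in> A) \<longrightarrow> (\<exists>r l. strict_mono r \<and> uaw_tendsto (x \<circ> r) l))"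


section \<open>Banach lattices as structures on a carrier set\<close>

text \<open>
  A statement of the form ``for every Banach lattice \<open>G\<close>'' cannot quantify over types inside
  a formula.  Banach lattices that are quantified over are therefore represented by explicit
  structures whose carrier is a subset of some type \<open>'g\<close>; the operations are only
  meaningful on the carrier.  Lemma \<open>banach_lattice_on_type\<close> below connects the two forms.
  As in a choice of universe, \<open>'g\<close> must be large enough to hold (a copy of) \<open>ell1\<close>,
  which is expressed by an injection from \<open>nat \<Rightarrow> real\<close> into \<open>'g\<close>.  This excludes only types
  that are too small to carry any nonzero Banach lattice, since such a lattice contains a line.
\<close>

record 'g lattice_structure =
  bl_carrier :: "'g set"
  bl_zero :: 'g
  bl_add :: "'g \<Rightarrow> 'g \<Rightarrow> 'g"
  bl_scale :: "real \<Rightarrow> 'g \<Rightarrow> 'g"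
  bl_le :: "'g \<Rightarrow> 'g \<Rightarrow> bool"
  bl_norm :: "'g \<Rightarrow> real"

definition bl_minus :: "'g lattice_structure \<Rightarrow> 'g \<Rightarrow> 'g" where
  "bl_minus G x = bl_scale G (-1) x"

definition bl_is_sup :: "'g lattice_structure \<Rightarrow> 'g \<Rightarrow> 'g \<Rightarrow> 'g \<Rightarrow> bool" where
  "bl_is_sup G x y s \<longleftrightarrow> s \<in> bl_carrier G \<and> bl_le G x s \<and> bl_le G y s \<and>
     (\<forall>z\<in>bl_carrier G. bl_le G x z \<and> bl_le G y z \<longrightarrow> bl_le G s z)"

definition bl_is_inf :: "'g lattice_structure \<Rightarrow> 'g \<Rightarrow> 'g \<Rightarrow> 'g \<Rightarrow> bool" where
  "bl_is_inf G x y s \<longleftrightarrow> s \<in> bl_carrier G \<and> bl_le G s x \<and> bl_le G s y \<and>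
     (\<forall>z\<in>bl_carrier G. bl_le G z x \<and> bl_le G z y \<longrightarrow> bl_le G z s)"

text \<open>In axiom \<open>norm_mono_abs\<close>, \<open>a\<close> and \<open>b\<close> are the absolute values of \<open>x\<close> and \<open>y\<close>.\<close>

locale banach_lattice_on =
  fixes G :: "'g lattice_structure"
  assumes zero_closed: "bl_zero G \<in> bl_carrier G"
    and add_closed: "\<lbrakk>x \<in> bl_carrier G; y \<in> bl_carrier G\<rbrakk> \<Longrightarrow> bl_add G x y \<in> bl_carrier G"
    and scale_closed: "x \<in> bl_carrier G \<Longrightarrow> bl_scale G c x \<in> bl_carrier G"
    and add_assoc: "\<lbrakk>x \<in> bl_carrier G; y \<in> bl_carrier G; z \<in> bl_carrier G\<rbrakk> \<Longrightarrow>
      bl_add G (bl_add G x y) z = bl_add G x (bl_add G y z)"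
    and add_commute: "\<lbrakk>x \<in> bl_carrier G; y \<in> bl_carrier G\<rbrakk> \<Longrightarrow> bl_add G x y = bl_add G y x"
    and add_zero: "x \<in> bl_carrier G \<Longrightarrow> bl_add G x (bl_zero G) = x"
    and add_minus: "x \<in> bl_carrier G \<Longrightarrow> bl_add G x (bl_minus G x) = bl_zero G"
    and scale_add_right: "\<lbrakk>x \<in> bl_carrier G; y \<in> bl_carrier G\<rbrakk> \<Longrightarrow>
      bl_scale G c (bl_add G x y) = bl_add G (bl_scale G c x) (bl_scale G c y)"
    and scale_add_left: "x \<in> bl_carrier G \<Longrightarrow>
      bl_scale G (c + d) x = bl_add G (bl_scale G c x) (bl_scale G d x)"
    and scale_scale: "x \<in> bl_carrier G \<Longrightarrow> bl_scale G c (bl_scale G d x) = bl_scale G (c * d) x"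
    and scale_one: "x \<in> bl_carrier G \<Longrightarrow> bl_scale G 1 x = x"
    and le_refl: "x \<in> bl_carrier G \<Longrightarrow> bl_le G x x"
    and le_antisym: "\<lbrakk>x \<in> bl_carrier G; y \<in> bl_carrier G; bl_le G x y; bl_le G y x\<rbrakk> \<Longrightarrow> x = y"
    and le_trans: "\<lbrakk>x \<in> bl_carrier G; y \<in> bl_carrier G; z \<in> bl_carrier G;
      bl_le G x y; bl_le G y z\<rbrakk> \<Longrightarrow> bl_le G x z"
    and sup_exists: "\<lbrakk>x \<in> bl_carrier G; y \<in> bl_carrier G\<rbrakk> \<Longrightarrow> \<exists>s. bl_is_sup G x y s"
    and inf_exists: "\<lbrakk>x \<in> bl_carrier G; y \<in> bl_carrier G\<rbrakk> \<Longrightarrow> \<exists>s. bl_is_inf G x y s"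
    and add_mono: "\<lbrakk>x \<in> bl_carrier G; y \<in> bl_carrier G; z \<in> bl_carrier G; bl_le G x y\<rbrakk> \<Longrightarrow>
      bl_le G (bl_add G x z) (bl_add G y z)"
    and scale_mono: "\<lbrakk>x \<in> bl_carrier G; y \<in> bl_carrier G; bl_le G x y; 0 \<le> c\<rbrakk> \<Longrightarrow>
      bl_le G (bl_scale G c x) (bl_scale G c y)"
    and norm_eq_zero: "x \<in> bl_carrier G \<Longrightarrow> bl_norm G x = 0 \<longleftrightarrow> x = bl_zero G"
    and norm_triangle: "\<lbrakk>x \<in> bl_carrier G; y \<in> bl_carrier G\<rbrakk> \<Longrightarrow>
      bl_norm G (bl_add G x y) \<le> bl_norm G x + bl_norm G y"
    and norm_scale: "x \<in> bl_carrier G \<Longrightarrow> bl_norm G (bl_scale G c x) = \<bar>c\<bar> * bl_norm G x"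
    and norm_mono_abs: "\<lbrakk>x \<in> bl_carrier G; y \<in> bl_carrier G;
      bl_is_sup G x (bl_minus G x) a; bl_is_sup G y (bl_minus G y) b; bl_le G a b\<rbrakk> \<Longrightarrow>
      bl_norm G x \<le> bl_norm G y"
    and norm_complete: "\<lbrakk>\<And>n. u n \<in> bl_carrier G;
      \<And>e. 0 < e \<Longrightarrow> \<exists>N::nat. \<forall>m\<ge>N. \<forall>n\<ge>N. bl_norm G (bl_add G (u m) (bl_minus G (u n))) < e\<rbrakk> \<Longrightarrow>
      \<exists>l\<in>bl_carrier G. (\<lambda>n. bl_norm G (bl_add G (u n) (bl_minus G l))) \<longlonglongrightarrow> 0"

definition type_lattice :: "'e::banach_lattice lattice_structure" where
  "type_lattice = \<lparr>bl_carrier = UNIV, bl_zero = 0, bl_add = (+), bl_scale = (*\<^sub>R),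
     bl_le = (\<le>), bl_norm = norm\<rparr>"

definition ell1 :: "(nat \<Rightarrow> real) lattice_structure" where
  "ell1 = \<lparr>bl_carrier = {x. summable (\<lambda>i. \<bar>x i\<bar>)}, bl_zero = (\<lambda>i. 0),
     bl_add = (\<lambda>x y i. x i + y i), bl_scale = (\<lambda>c x i. c * x i),
     bl_le = (\<lambda>x y. \<forall>i. x i \<le> y i), bl_norm = (\<lambda>x. \<Sum>i. \<bar>x i\<bar>)\<rparr>"

definition bounded_linear_from ::
    "'g lattice_structure \<Rightarrow> ('g \<Rightarrow> 'y::real_normed_vector) \<Rightarrow> bool" where
  "bounded_linear_from G S \<longleftrightarrow>
     (\<forall>x\<in>bl_carrier G. \<forall>y\<in>bl_carrier G. S (bl_add G x y) = S x + S y) \<and>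
     (\<forall>c. \<forall>x\<in>bl_carrier G. S (bl_scale G c x) = c *\<^sub>R S x) \<and>
     (\<exists>K. \<forall>x\<in>bl_carrier G. norm (S x) \<le> K * bl_norm G x)"

definition compact_from ::
    "'g lattice_structure \<Rightarrow> ('g \<Rightarrow> 'y::real_normed_vector) \<Rightarrow> bool" where
  "compact_from G R \<longleftrightarrow> compact (closure (R ` {x \<in> bl_carrier G. bl_norm G x \<le> 1}))"

lemma banach_lattice_on_type: "banach_lattice_on (type_lattice :: 'e::banach_lattice lattice_structure)"
proof -
  have sup: "bl_is_sup (type_lattice :: 'e lattice_structure) x y s \<longleftrightarrow> s = sup x y" for x y s
    by (auto simp: bl_is_sup_def type_lattice_def intro: antisym)
  have inf: "bl_is_inf (type_lattice :: 'e lattice_structure) x y s \<longleftrightarrow> s = inf x y" for x y s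
    by (auto simp: bl_is_inf_def type_lattice_def intro: antisym)
  show ?thesis
  proof (unfold_locales, goal_cases)
    case (22 x y a b)
    then have "a = \<bar>x\<bar>" "b = \<bar>y\<bar>"
      unfolding sup by (simp_all add: bl_minus_def type_lattice_def abs_lattice)
    with 22 show ?case by (auto simp: type_lattice_def intro: norm_mono_abs)
  next
    case (15 x y)
    show ?case using sup by blast
  next
    case (16 x y)
    show ?case using inf by blast
  next
    case (23 u)
    then have "Cauchy u"
      unfolding Cauchy_def dist_norm by (simp add: type_lattice_def bl_minus_def)
    then obtain l where "u \<longlonglongrightarrow> l"
      using Cauchy_convergent convergent_def by blast
    then have "(\<lambda>n. norm (u n - l)) \<longlonglongrightarrow> 0"
      by (simp add: LIM_zero tendsto_norm_zero)
    then show ?case by (auto simp: type_lattice_def bl_minus_def)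
  qed (auto simp: sup inf type_lattice_def bl_minus_def algebra_simps norm_triangle_ineq
      scaleR_left_mono)
qed

lemma banach_lattice_on_ell1: "banach_lattice_on ell1"
proof -
  have sm: "summable (\<lambda>i. \<bar>x i + y i\<bar>)" if "summable (\<lambda>i. \<bar>x i\<bar>)" "summable (\<lambda>i. \<bar>y i\<bar>)"
    for x y :: "nat \<Rightarrow> real"
    by (rule summable_comparison_test'[OF summable_add[OF that], of 0]) auto
  have smc: "summable (\<lambda>i. \<bar>c * x i\<bar>)" if "summable (\<lambda>i. \<bar>x i\<bar>)" for c and x :: "nat \<Rightarrow> real"
    using summable_mult[OF that, of "\<bar>c\<bar>"] by (simp add: abs_mult)
  have smsup: "summable (\<lambda>i. \<bar>max (x i) (y i)\<bar>)" "summable (\<lambda>i. \<bar>min (x i) (y i)\<bar>)"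
    if "summable (\<lambda>i. \<bar>x i\<bar>)" "summable (\<lambda>i. \<bar>y i\<bar>)" for x y :: "nat \<Rightarrow> real"
    by (rule summable_comparison_test'[OF summable_add[OF that], of 0]; auto simp: max_def min_def)+
  have supI: "bl_is_sup ell1 x y (\<lambda>i. max (x i) (y i))"
    and infI: "bl_is_inf ell1 x y (\<lambda>i. min (x i) (y i))"
    if "x \<in> bl_carrier ell1" "y \<in> bl_carrier ell1" for x y
    using that smsup[of x y] by (auto simp: bl_is_sup_def bl_is_inf_def ell1_def)
  have supE: "s = (\<lambda>i. max (x i) (y i))"
    if "bl_is_sup ell1 x y s" "x \<in> bl_carrier ell1" "y \<in> bl_carrier ell1" for x y s
  proof -
    have "\<forall>i. s i \<le> max (x i) (y i)" "\<forall>i. max (x i) (y i) \<le> s i"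
      using that supI[OF that(2,3)] by (auto simp: bl_is_sup_def ell1_def)
    then show ?thesis by (auto simp: fun_eq_iff intro: antisym)
  qed
  show ?thesis
  proof (unfold_locales, goal_cases)
    case (13 x y) then show ?case by (auto simp: ell1_def fun_eq_iff intro: antisym)
  next
    case (15 x y) then show ?case using supI by blast
  next
    case (16 x y) then show ?case using infI by blast
  next
    case (19 x)
    then have s: "summable (\<lambda>i. \<bar>x i\<bar>)" by (simp add: ell1_def)
    show ?case using suminf_eq_zero_iff[OF s] by (auto simp: ell1_def)
  next
    case (20 x y)
    then have s: "summable (\<lambda>i. \<bar>x i\<bar>)" "summable (\<lambda>i. \<bar>y i\<bar>)" by (simp_all add: ell1_def)
    have "(\<Sum>i. \<bar>x i + y i\<bar>) \<le> (\<Sum>i. \<bar>x i\<bar> + \<bar>y i\<bar>)"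
      by (rule suminf_le) (use sm[OF s] summable_add[OF s] in auto)
    then show ?case using suminf_add[OF s] by (simp add: ell1_def)
  next
    case (21 x c)
    then show ?case by (simp add: ell1_def abs_mult suminf_mult)
  next
    case (22 x y a b)
    have neg: "bl_minus ell1 x \<in> bl_carrier ell1" "bl_minus ell1 y \<in> bl_carrier ell1"
      using 22 by (simp_all add: bl_minus_def ell1_def)
    have "a = (\<lambda>i. \<bar>x i\<bar>)" "b = (\<lambda>i. \<bar>y i\<bar>)"
      using supE[OF 22(3) 22(1) neg(1)] supE[OF 22(4) 22(2) neg(2)]
      by (auto simp: bl_minus_def ell1_def)
    with 22 show ?case by (auto simp: ell1_def intro!: suminf_le)
  next
    case (23 u)
    have u: "summable (\<lambda>i. \<bar>u n i\<bar>)" for n using 23(1)[of n] by (simp add: ell1_def)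
    have ud: "summable (\<lambda>i. \<bar>u m i - u n i\<bar>)" for m n
      using sm[OF u[of m] smc[OF u[of n], of "-1"]] by simp
    have C: "\<exists>N. \<forall>m\<ge>N. \<forall>n\<ge>N. (\<Sum>i. \<bar>u m i - u n i\<bar>) < e" if "0 < e" for e
      using 23(2)[OF that] by (simp add: ell1_def bl_minus_def)
    have "convergent (\<lambda>n. u n i)" for i
    proof -
      have le: "\<bar>u m i - u n i\<bar> \<le> (\<Sum>i. \<bar>u m i - u n i\<bar>)" for m n
        using sum_le_suminf[OF ud[of m n], of "{i}"] by simp
      have "Cauchy (\<lambda>n. u n i)"
        unfolding Cauchy_def dist_real_def by (meson C le le_less_trans)
      then show ?thesis using Cauchy_convergent_iff by blast
    qed
    then have "\<forall>i. \<exists>l. (\<lambda>n. u n i) \<longlonglongrightarrow> l" by (simp add: convergent_def)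
    then obtain l where l: "(\<lambda>n. u n i) \<longlonglongrightarrow> l i" for i by metis
    have fin: "(\<Sum>i<k. \<bar>u n i - l i\<bar>) \<le> e"
      if N: "\<forall>m\<ge>N. \<forall>n\<ge>N. (\<Sum>i. \<bar>u m i - u n i\<bar>) < e" and "n \<ge> N" for e N n k
    proof (rule LIMSEQ_le_const2)
      show "(\<lambda>m. \<Sum>i<k. \<bar>u n i - u m i\<bar>) \<longlonglongrightarrow> (\<Sum>i<k. \<bar>u n i - l i\<bar>)"
        by (intro tendsto_intros l)
      have "(\<Sum>i<k. \<bar>u n i - u m i\<bar>) \<le> e" if "m \<ge> N" for m
        using sum_le_suminf[OF ud[of n m], of "{..<k}"] N that \<open>n \<ge> N\<close> by fastforce
      then show "\<exists>N. \<forall>m\<ge>N. (\<Sum>i<k. \<bar>u n i - u m i\<bar>) \<le> e" by blast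
    qed
    have dsum: "summable (\<lambda>i. \<bar>u n i - l i\<bar>)" and dle: "(\<Sum>i. \<bar>u n i - l i\<bar>) \<le> e"
      if N: "\<forall>m\<ge>N. \<forall>n\<ge>N. (\<Sum>i. \<bar>u m i - u n i\<bar>) < e" and "n \<ge> N" for e N n
    proof -
      show s: "summable (\<lambda>i. \<bar>u n i - l i\<bar>)"
        by (rule bounded_imp_summable[of _ e])
          (use fin[OF that, of "Suc _"] in \<open>auto simp: lessThan_Suc_atMost\<close>)
      show "(\<Sum>i. \<bar>u n i - l i\<bar>) \<le> e"
        by (rule suminf_le_const[OF s]) (use fin[OF that] in auto)
    qed
    obtain N where N: "\<forall>m\<ge>N. \<forall>n\<ge>N. (\<Sum>i. \<bar>u m i - u n i\<bar>) < 1" using C[of 1] by auto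
    have ls: "summable (\<lambda>i. \<bar>l i\<bar>)"
      using sm[OF u[of N] smc[OF dsum[OF N order_refl], of "1"]]
        sm[OF u[of N], of "\<lambda>i. l i - u N i"] dsum[OF N order_refl]
      by (simp add: abs_minus_commute)
    have "(\<lambda>n. \<Sum>i. \<bar>u n i - l i\<bar>) \<longlonglongrightarrow> 0"
    proof (rule LIMSEQ_I)
      fix e :: real assume "0 < e"
      then obtain N where N: "\<forall>m\<ge>N. \<forall>n\<ge>N. (\<Sum>i. \<bar>u m i - u n i\<bar>) < e / 2"
        using C[of "e/2"] by auto
      have "norm ((\<Sum>i. \<bar>u n i - l i\<bar>) - 0) < e" if "n \<ge> N" for n
        using dle[OF N that] suminf_nonneg[OF dsum[OF N that]] \<open>0 < e\<close> by auto
      then show "\<exists>N. \<forall>n\<ge>N. norm ((\<Sum>i. \<bar>u n i - l i\<bar>) - 0) < e" by blast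
    qed
    with ls show ?case by (intro bexI[of _ l]) (simp_all add: ell1_def bl_minus_def)
  qed (auto simp: ell1_def bl_minus_def sm smc algebra_simps mult_left_mono intro: order_trans)
qed

end

theory Submission
  imports Defs
begin

text \<open>
  In an atomic KB-space every positive \<open>u\<close> is the unconditional norm sum of its components
  \<open>coord u a *\<^sub>R a\<close> along the normalized atoms.  Hence coordinatewise convergence of a bounded
  sequence forces \<open>norm (inf \<bar>x n - l\<bar> u)\<close> to tend to 0: up to a small remainder \<open>u\<close> is a finite
  combination of atoms.  Each element has countable support and the coordinates are bounded, so a
  diagonal argument, together with summability of norm bounded positive families, shows that every
  bounded sequence has a uaw-convergent subsequence.  This gives (1) to (2) and (1) to (3).
  Conversely (2) and (4) place \<open>T (x n)\<close>, for \<open>x\<close> bounded and uaw-null, in a norm compact set (for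
  (4), through the operator on \<open>\<ell>\<^sup>1\<close> sending the unit vectors to \<open>x n\<close>); unbounded continuity makes
  \<open>T (x n)\<close> weakly null, and a weakly null sequence in a compact set is norm null, since bounded
  functionals separate points.
\<close>

section \<open>Norming functionals\<close>

definition sublinear :: "('a::real_vector \<Rightarrow> real) \<Rightarrow> bool" where
  "sublinear q \<longleftrightarrow> (\<forall>x y. q (x + y) \<le> q x + q y) \<and> (\<forall>t>0. \<forall>x. q (t *\<^sub>R x) \<le> t * q x)"

lemma sublinear_add: "sublinear q \<Longrightarrow> q (x + y) \<le> q x + q y"
  by (simp add: sublinear_def)

text \<open>Using the defining inequality for \<open>inverse t\<close> as well gives the reverse
  one. The definition can therefore ask for a single inequality, which is the convenient form when
  infima are checked.\<close>

lemma sublinear_scaleR: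
  assumes "sublinear q" "0 < t"
  shows "q (t *\<^sub>R x) = t * q x"
proof (rule antisym)
  show "q (t *\<^sub>R x) \<le> t * q x" using assms by (simp add: sublinear_def)
  have "q (inverse t *\<^sub>R (t *\<^sub>R x)) \<le> inverse t * q (t *\<^sub>R x)"
    using assms unfolding sublinear_def by (meson positive_imp_inverse_positive)
  then show "t * q x \<le> q (t *\<^sub>R x)" using assms(2) by (simp add: field_simps)
qed

lemma sublinear_zero: "sublinear q \<Longrightarrow> q 0 = 0"
  using sublinear_scaleR[of q 2 0] by simp

lemma sublinear_ge_neg: "sublinear q \<Longrightarrow> - q (- x) \<le> q x"
  using sublinear_add[of q x "- x"] sublinear_zero[of q] by simp

text \<open>Provides the bounds of chains for Zorn's lemma. In \<open>q x + r y\<close> the two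
  members may differ; comparability yields one member \<open>s\<close> below both, and subadditivity
  of \<open>s\<close> finishes.\<close>

lemma sublinear_INF_chain:
  assumes sub: "\<And>q. q \<in> C \<Longrightarrow> sublinear q" and ne: "C \<noteq> {}"
    and bd: "\<And>x. bdd_below ((\<lambda>q. q x) ` C)"
    and chain: "\<And>q r. q \<in> C \<Longrightarrow> r \<in> C \<Longrightarrow> q \<le> r \<or> r \<le> q"
  shows "sublinear (\<lambda>x. INF q\<in>C. q x)"
  unfolding sublinear_def
proof (intro conjI allI impI)
  let ?u = "\<lambda>x. INF q\<in>C. q x"
  have low: "?u x \<le> q x" if "q \<in> C" for q x
    using that bd by (rule cINF_lower[rotated])
  fix x y
  have key: "?u (x + y) \<le> q x + r y" if qr: "q \<in> C" "r \<in> C" for q r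
  proof -
    obtain s where s: "s \<in> C" "s \<le> q" "s \<le> r" using chain[OF qr] qr by blast
    have "?u (x + y) \<le> s x + s y"
      using low[OF s(1), of "x + y"] sublinear_add[OF sub[OF s(1)], of x y] by linarith
    also have "\<dots> \<le> q x + r y" using s by (intro add_mono) (auto simp: le_fun_def)
    finally show ?thesis .
  qed
  have "?u (x + y) - r y \<le> ?u x" if "r \<in> C" for r
    by (rule cINF_greatest[OF ne]) (use key[OF _ that] in \<open>simp add: algebra_simps\<close>)
  then have "?u (x + y) - ?u x \<le> ?u y"
    by (intro cINF_greatest[OF ne]) (simp add: algebra_simps)
  then show "?u (x + y) \<le> ?u x + ?u y" by simp
next
  fix t :: real and x assume "0 < t"
  have "(INF q\<in>C. q (t *\<^sub>R x)) / t \<le> (INF q\<in>C. q x)"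
  proof (rule cINF_greatest[OF ne])
    fix q assume "q \<in> C"
    then have "(INF q\<in>C. q (t *\<^sub>R x)) \<le> q (t *\<^sub>R x)" using bd by (rule cINF_lower[rotated])
    also have "\<dots> = t * q x" using sublinear_scaleR[OF sub[OF \<open>q \<in> C\<close>] \<open>0 < t\<close>] .
    finally show "(INF q\<in>C. q (t *\<^sub>R x)) / t \<le> q x" using \<open>0 < t\<close> by (simp add: field_simps)
  qed
  then show "(INF q\<in>C. q (t *\<^sub>R x)) \<le> t * (INF q\<in>C. q x)"
    using \<open>0 < t\<close> by (simp add: field_simps)
qed

text \<open>For sublinear \<open>q\<close> this is the largest sublinear function below
  \<open>q\<close> whose value at \<open>- y\<close> is at most \<open>- q y\<close>; it is the
  auxiliary function of the Hahn-Banach argument.\<close>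

definition sublinear_lowering :: "('a::real_vector \<Rightarrow> real) \<Rightarrow> 'a \<Rightarrow> 'a \<Rightarrow> real" where
  "sublinear_lowering q y x = (INF t\<in>{0..}. q (x + t *\<^sub>R y) - t * q y)"

lemma sublinear_lowering_le:
  assumes "sublinear q" "0 \<le> t"
  shows "sublinear_lowering q y x \<le> q (x + t *\<^sub>R y) - t * q y"
  unfolding sublinear_lowering_def
proof (rule cINF_lower)
  \<comment> \<open>A real infimum says something only if the set is bounded below; subadditivity
    gives the bound \<open>- q (- x)\<close>, which does not depend on \<open>t\<close>.\<close>
  show "bdd_below ((\<lambda>t. q (x + t *\<^sub>R y) - t * q y) ` {0..})"
  proof (rule bdd_belowI2)
    fix t :: real assume "t \<in> {0..}"
    then have "q (t *\<^sub>R y) = t * q y"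
      using sublinear_scaleR[OF assms(1)] sublinear_zero[OF assms(1)]
      by (cases "t = 0") auto
    moreover have "q (t *\<^sub>R y) \<le> q (x + t *\<^sub>R y) + q (- x)"
      using sublinear_add[OF assms(1), of "x + t *\<^sub>R y" "- x"] by simp
    ultimately show "- q (- x) \<le> q (x + t *\<^sub>R y) - t * q y" by linarith
  qed
qed (use assms in simp)

lemma sublinear_lowering:
  assumes q: "sublinear q"
  shows "sublinear (sublinear_lowering q y)"
  unfolding sublinear_def
proof (intro conjI allI impI)
  let ?l = "sublinear_lowering q y"
  fix x x'
  \<comment> \<open>The shifts add up: \<open>t\<close> for \<open>x\<close> and \<open>s\<close>
    for \<open>x'\<close> are matched by \<open>t + s\<close> for the sum. Taking infima over
    \<open>t\<close> and then over \<open>s\<close> gives subadditivity.\<close>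
  have key: "?l (x + x') \<le> (q (x + t *\<^sub>R y) - t * q y) + (q (x' + s *\<^sub>R y) - s * q y)"
    if "0 \<le> t" "0 \<le> s" for t s
  proof -
    have "?l (x + x') \<le> q ((x + x') + (t + s) *\<^sub>R y) - (t + s) * q y"
      using that by (intro sublinear_lowering_le[OF q]) simp
    also have "(x + x') + (t + s) *\<^sub>R y = (x + t *\<^sub>R y) + (x' + s *\<^sub>R y)"
      by (simp add: algebra_simps)
    also have "q \<dots> \<le> q (x + t *\<^sub>R y) + q (x' + s *\<^sub>R y)" by (rule sublinear_add[OF q])
    finally show ?thesis by (simp add: algebra_simps)
  qed
  have "?l (x + x') - (q (x' + s *\<^sub>R y) - s * q y) \<le> ?l x" if "0 \<le> s" for s
    unfolding sublinear_lowering_def[of q y x]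
    by (rule cINF_greatest) (use key[OF _ that] in \<open>auto simp: algebra_simps\<close>)
  then have "?l (x + x') - ?l x \<le> ?l x'"
    unfolding sublinear_lowering_def[of q y x']
    by (intro cINF_greatest) (auto simp: algebra_simps)
  then show "?l (x + x') \<le> ?l x + ?l x'" by simp
next
  let ?l = "sublinear_lowering q y"
  fix s :: real and x assume s: "0 < s"
  have "?l (s *\<^sub>R x) / s \<le> ?l x"
    unfolding sublinear_lowering_def[of q y x]
  proof (rule cINF_greatest)
    fix t :: real assume "t \<in> {0..}"
    then have "?l (s *\<^sub>R x) \<le> q (s *\<^sub>R x + (s * t) *\<^sub>R y) - (s * t) * q y"
      using s by (intro sublinear_lowering_le[OF q]) simp
    also have "s *\<^sub>R x + (s * t) *\<^sub>R y = s *\<^sub>R (x + t *\<^sub>R y)" by (simp add: scaleR_add_right)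
    also have "q \<dots> = s * q (x + t *\<^sub>R y)" by (rule sublinear_scaleR[OF q s])
    finally show "?l (s *\<^sub>R x) / s \<le> q (x + t *\<^sub>R y) - t * q y"
      using s by (simp add: field_simps)
  qed simp
  then show "?l (s *\<^sub>R x) \<le> s * ?l x" using s by (simp add: field_simps)
qed

text \<open>Lowering \<open>q\<close> along \<open>y\<close> gives a sublinear function below
  \<open>q\<close>, which by minimality is \<open>q\<close> itself. Its bound for
  \<open>t = 1\<close> is then \<open>q x <= q (x + y) - q y\<close>, the missing half of
  additivity.\<close>

lemma minimal_sublinear_imp_linear:
  assumes q: "sublinear q" and min: "\<And>r. sublinear r \<Longrightarrow> r \<le> q \<Longrightarrow> r = q"
  shows "linear q"
proof -
  have add: "q (x + y) = q x + q y" for x y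
  proof (rule antisym[OF sublinear_add[OF q]])
    have "sublinear_lowering q y \<le> q"
      using sublinear_lowering_le[OF q order_refl, of y] by (simp add: le_fun_def)
    then have "sublinear_lowering q y = q" by (rule min[OF sublinear_lowering[OF q]])
    then show "q x + q y \<le> q (x + y)"
      using sublinear_lowering_le[OF q zero_le_one, of y x] by simp
  qed
  have neg: "q (- x) = - q x" for x
    using add[of x "- x"] sublinear_zero[OF q] by simp
  show ?thesis
  proof (rule linearI)
    fix t x
    show "q (t *\<^sub>R x) = t *\<^sub>R q x"
      using sublinear_scaleR[OF q, of t x] sublinear_scaleR[OF q, of "- t" x] neg[of "t *\<^sub>R x"]
        sublinear_zero[OF q]
      by (cases t "0::real" rule: linorder_cases) auto
  qed (rule add)
qed

lemma sublinear_dominates_linear: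
  assumes p: "sublinear p"
  obtains f where "linear f" "f \<le> p"
proof -
  \<comment> \<open>The order \<open>?P\<close> is reversed, so the maximal element supplied by
    Zorn's lemma is a minimal sublinear function below \<open>p\<close>.\<close>
  let ?A = "{q. sublinear q \<and> q \<le> p}" and ?P = "\<lambda>a b :: 'a \<Rightarrow> real. b \<le> a"
  have "\<exists>m\<in>?A. \<forall>a\<in>?A. ?P m a \<longrightarrow> a = m"
  proof (rule predicate_Zorn)
    show "partial_order_on ?A (relation_of ?P ?A)"
      by (rule partial_order_on_relation_ofI) auto
  next
    fix C assume "C \<in> Chains (relation_of ?P ?A)"
    then have C: "C \<subseteq> ?A" and chain: "\<And>q r. q \<in> C \<Longrightarrow> r \<in> C \<Longrightarrow> q \<le> r \<or> r \<le> q"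
      unfolding Chains_def relation_of_def by auto
    show "\<exists>u\<in>?A. \<forall>a\<in>C. ?P a u"
    proof (cases "C = {}")
      case True then show ?thesis using p by blast
    next
      case False
      have bd: "bdd_below ((\<lambda>q. q x) ` C)" for x
      proof (rule bdd_belowI2)
        fix q assume "q \<in> C"
        then have "sublinear q" "q (- x) \<le> p (- x)" using C by (auto simp: le_fun_def)
        then show "- p (- x) \<le> q x" using sublinear_ge_neg[of q x] by linarith
      qed
      have low: "(INF q\<in>C. q x) \<le> q x" if "q \<in> C" for q x
        using that bd by (rule cINF_lower[rotated])
      have "sublinear (\<lambda>x. INF q\<in>C. q x)"
        using C bd chain False by (intro sublinear_INF_chain) auto
      moreover have "(\<lambda>x. INF q\<in>C. q x) \<le> p"
      proof (rule le_funI)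
        fix x
        obtain q where q: "q \<in> C" using False by blast
        then have "q x \<le> p x" using C by (auto simp: le_fun_def)
        with low[OF q, of x] show "(INF q\<in>C. q x) \<le> p x" by linarith
      qed
      ultimately show ?thesis
        using low by (intro bexI[of _ "\<lambda>x. INF q\<in>C. q x"]) (auto simp: le_fun_def)
    qed
  qed
  then obtain q where q: "sublinear q" "q \<le> p" and "\<forall>r. sublinear r \<and> r \<le> p \<longrightarrow> r \<le> q \<longrightarrow> r = q"
    by auto
  then have "r = q" if "sublinear r" "r \<le> q" for r
    using that order_trans[OF that(2) q(2)] by blast
  with q show ?thesis using minimal_sublinear_imp_linear that by blast
qed

text \<open>Lowering the norm in the direction \<open>y\<close> forces \<open>f (- y) \<le> - norm y\<close> for every linear
  \<open>f\<close> below it.\<close>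

lemma norming_functional:
  fixes y :: "'a::real_normed_vector"
  obtains f :: "'a \<Rightarrow> real" where "bounded_linear f" "f y = norm y"
proof -
  have n: "sublinear (norm :: 'a \<Rightarrow> real)"
    by (simp add: sublinear_def norm_triangle_ineq)
  obtain f where f: "linear f" "f \<le> sublinear_lowering norm y"
    using sublinear_dominates_linear[OF sublinear_lowering[OF n]] by metis
  have le: "f x \<le> norm (x + t *\<^sub>R y) - t * norm y" if "0 \<le> t" for x t
    using f(2) sublinear_lowering_le[OF n that, of y x] unfolding le_fun_def
    by (meson order_trans)
  have le_norm: "f x \<le> norm x" for x using le[of 0 x] by simp
  have abs: "\<bar>f x\<bar> \<le> norm x" for x
    using le_norm[of x] le_norm[of "- x"] linear_neg[OF f(1), of x] by simp
  have "f y = norm y"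
    using le_norm[of y] le[of 1 "- y"] linear_neg[OF f(1), of y] by simp
  moreover have "bounded_linear f"
    by (rule bounded_linear_intro[of f 1])
      (use abs linear_add[OF f(1)] linear_scale[OF f(1)] in auto)
  ultimately show ?thesis using that by blast
qed

section \<open>Weakly null sequences and compactness\<close>

text \<open>A functional norming \<open>y\<close> takes values on the sequence that tend to
  \<open>norm y\<close> by norm convergence and to 0 by weak convergence.\<close>

lemma weakly_tendsto_0_LIMSEQ:
  assumes "weakly_tendsto x 0" "x \<longlonglongrightarrow> y"
  shows "y = 0"
proof -
  obtain f where f: "bounded_linear f" "f y = norm y" by (rule norming_functional)
  have "(\<lambda>n. f (x n)) \<longlonglongrightarrow> f y" by (rule bounded_linear.tendsto[OF f(1) assms(2)])
  moreover have "(\<lambda>n. f (x n)) \<longlonglongrightarrow> f 0" using assms(1) f(1) by (simp add: weakly_tendsto_def)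
  ultimately have "f y = f 0" by (rule LIMSEQ_unique)
  then show ?thesis using f by (simp add: linear_simps)
qed

lemma weakly_tendsto_subseq:
  fixes x :: "nat \<Rightarrow> 'a::real_normed_vector"
  assumes "weakly_tendsto x l" "strict_mono r"
  shows "weakly_tendsto (x \<circ> r) l"
  unfolding weakly_tendsto_def
proof (intro allI impI)
  fix f :: "'a \<Rightarrow> real" assume "bounded_linear f"
  then have "(\<lambda>n. f (x n)) \<longlonglongrightarrow> f l" using assms(1) by (simp add: weakly_tendsto_def)
  from LIMSEQ_subseq_LIMSEQ[OF this assms(2)] show "(\<lambda>n. f ((x \<circ> r) n)) \<longlonglongrightarrow> f l"
    by (simp add: o_def)
qed

text \<open>Otherwise some subsequence keeps norm at least \<open>e\<close>. Compactness gives a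
  further subsequence with a norm limit, whose norm is at least \<open>e\<close> although it must
  equal the weak limit 0.\<close>

lemma weakly_null_in_compact_imp_null:
  assumes w: "weakly_tendsto x 0" and K: "compact K" "\<And>n. x n \<in> K"
  shows "x \<longlonglongrightarrow> 0"
proof (rule ccontr)
  assume "\<not> x \<longlonglongrightarrow> 0"
  then obtain e where e: "0 < e" "\<forall>N. \<exists>n\<ge>N. e \<le> norm (x n)"
    unfolding lim_sequentially by (auto simp: not_less)
  then have "infinite {n. e \<le> norm (x n)}"
    by (simp add: infinite_nat_iff_unbounded_le)
  then obtain r :: "nat \<Rightarrow> nat" where r: "strict_mono r" "\<And>n. e \<le> norm (x (r n))"
    using infinite_enumerate[of "{n. e \<le> norm (x n)}"] by blast
  obtain y s where s: "strict_mono (s :: nat \<Rightarrow> nat)" "((x \<circ> r) \<circ> s) \<longlonglongrightarrow> y"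
    using K seq_compactE[of K "x \<circ> r"] by (metis comp_apply compact_eq_seq_compact_metric)
  have "weakly_tendsto ((x \<circ> r) \<circ> s) 0"
    by (intro weakly_tendsto_subseq w r s)
  then have "y = 0" using s(2) by (rule weakly_tendsto_0_LIMSEQ)
  moreover have "e \<le> norm y"
    using tendsto_norm[OF s(2)] by (rule LIMSEQ_le_const) (use r in auto)
  ultimately show False using e by simp
qed

text \<open>A sequence in the closure is shadowed by one in \<open>A\<close> at distances below
  \<open>1/(n+1)\<close>; a subsequence along which the shadow converges makes the original converge
  to the same limit.\<close>

lemma compact_closureI_subseq:
  fixes A :: "'a::metric_space set"
  assumes "\<And>x :: nat \<Rightarrow> 'a. (\<And>n. x n \<in> A) \<Longrightarrow> \<exists>r l. strict_mono r \<and> (x \<circ> r) \<longlonglongrightarrow> l"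
  shows "compact (closure A)"
  unfolding compact_eq_seq_compact_metric seq_compact_def
proof (intro allI impI)
  fix y :: "nat \<Rightarrow> 'a" assume y: "\<forall>n. y n \<in> closure A"
  have "\<exists>z\<in>A. dist z (y n) < inverse (Suc n)" for n
    using y closure_approachable[of "y n" A] by simp
  then obtain x where x: "\<And>n. x n \<in> A" "\<And>n. dist (x n) (y n) < inverse (Suc n)" by metis
  obtain r l where r: "strict_mono r" "(x \<circ> r) \<longlonglongrightarrow> l" using assms[of x] x(1) by blast
  have "(\<lambda>n. dist (x n) (y n)) \<longlonglongrightarrow> 0"
    by (rule tendsto_sandwich[OF _ _ tendsto_const LIMSEQ_inverse_real_of_nat])
      (use x(2) in \<open>auto intro!: always_eventually simp: less_imp_le\<close>)
  then have "(\<lambda>n. dist ((x \<circ> r) n) ((y \<circ> r) n)) \<longlonglongrightarrow> 0"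
    using LIMSEQ_subseq_LIMSEQ[OF _ r(1), of "\<lambda>n. dist (x n) (y n)"] by (simp add: o_def)
  from tendsto_add[OF this r(2)[unfolded tendsto_dist_iff[of _ l]]]
  have "(\<lambda>n. dist ((x \<circ> r) n) ((y \<circ> r) n) + dist ((x \<circ> r) n) l) \<longlonglongrightarrow> 0" by simp
  then have "(y \<circ> r) \<longlonglongrightarrow> l"
    unfolding tendsto_dist_iff[of _ l]
    by (rule tendsto_sandwich[OF _ _ tendsto_const, rotated 2]) (auto simp: dist_triangle3)
  moreover have "l \<in> closure A"
    using r(2) x(1) closure_sequential[of l A] by (metis comp_apply)
  ultimately show "\<exists>l\<in>closure A. \<exists>r. strict_mono r \<and> (y \<circ> r) \<longlonglongrightarrow> l" using r(1) by blast
qed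

lemma totally_bounded_iff_compact_closure:
  fixes A :: "'a::complete_space set"
  shows "totally_bounded A \<longleftrightarrow> compact (closure A)"
proof
  assume A: "totally_bounded A"
  have "\<exists>k. finite k \<and> closure A \<subseteq> (\<Union>x\<in>k. ball x e)" if "0 < e" for e
  proof -
    obtain k where k: "finite k" "A \<subseteq> (\<Union>x\<in>k. ball x (e/2))"
      using A \<open>0 < e\<close> unfolding totally_bounded_metric ball_def by (meson half_gt_zero)
    \<comment> \<open>A finite union of closed balls is closed, so it also covers the closure of
      \<open>A\<close>; radius \<open>e/2\<close> leaves room to return to open balls of radius
      \<open>e\<close>.\<close>
    have "A \<subseteq> (\<Union>x\<in>k. cball x (e/2))" using k(2) ball_subset_cball by blast
    then have "closure A \<subseteq> (\<Union>x\<in>k. cball x (e/2))"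
      by (rule closure_minimal) (use k(1) in auto)
    also have "\<dots> \<subseteq> (\<Union>x\<in>k. ball x e)" using \<open>0 < e\<close> by fastforce
    finally show ?thesis using k(1) by blast
  qed
  then show "compact (closure A)"
    unfolding compact_eq_totally_bounded by (simp add: complete_eq_closed)
next
  assume "compact (closure A)"
  then show "totally_bounded A"
    unfolding compact_eq_totally_bounded totally_bounded_metric ball_def[symmetric]
    using closure_subset by (meson order_trans)
qed

section \<open>Order and norm in Banach lattices\<close>

lemma norm_abs_banach_lattice [simp]: "norm \<bar>x\<bar> = norm (x :: 'a::banach_lattice)"
  by (intro antisym norm_mono_abs) simp_all

lemma norm_mono_nonneg: "0 \<le> x \<Longrightarrow> x \<le> y \<Longrightarrow> norm x \<le> norm (y :: 'a::banach_lattice)"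
  by (rule norm_mono_abs) simp

text \<open>Closedness of the positive cone. From \<open>0 <= f i\<close> follows
  \<open>- x <= \<bar>f i - x\<bar>\<close>, so the norm of \<open>pprt (- x)\<close> is at most the
  distance from \<open>f i\<close> to \<open>x\<close>, which becomes arbitrarily small.\<close>

lemma le_limit_nonneg:
  fixes x :: "'a::banach_lattice"
  assumes "(f \<longlongrightarrow> x) F" "F \<noteq> bot" "\<forall>\<^sub>F i in F. 0 \<le> f i"
  shows "0 \<le> x"
proof -
  have "pprt (- x) = 0"
  proof (rule ccontr)
    assume "pprt (- x) \<noteq> 0"
    then have "\<forall>\<^sub>F i in F. dist (f i) x < norm (pprt (- x))"
      by (intro tendstoD[OF assms(1)]) simp
    with assms(3) have "\<forall>\<^sub>F i in F. False"
    proof eventually_elim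
      fix i assume *: "0 \<le> f i" "dist (f i) x < norm (pprt (- x))"
      have "- x \<le> f i - x" using *(1) by simp
      also have "\<dots> \<le> \<bar>f i - x\<bar>" by (rule abs_ge_self)
      finally have "- x \<le> \<bar>f i - x\<bar>" .
      then have "pprt (- x) \<le> \<bar>f i - x\<bar>" by (simp add: pprt_def)
      then have "norm (pprt (- x)) \<le> norm \<bar>f i - x\<bar>" by (rule norm_mono_nonneg[rotated]) simp
      with *(2) show False by (simp add: dist_norm)
    qed
    with assms(2) show False by simp
  qed
  then show ?thesis using le_zero_iff_zero_pprt[of "- x"] by simp
qed

text \<open>Since addition distributes over \<open>inf\<close>, the right-hand side is the infimum
  of \<open>p + q\<close>, \<open>p + r\<close>, \<open>r + q\<close> and \<open>r + r\<close>, and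
  each of these dominates \<open>inf (p + q) r\<close>.\<close>

lemma inf_add_le:
  fixes p q r :: "'a::lattice_ab_group_add"
  assumes "0 \<le> p" "0 \<le> q" "0 \<le> r"
  shows "inf (p + q) r \<le> inf p r + inf q r"
proof -
  have "inf p r + inf q r = inf (inf (p + q) (p + r)) (inf (r + q) (r + r))"
    by (simp add: add_inf_distrib_left add_inf_distrib_right inf_aci)
  moreover have "inf (p + q) r \<le> p + r" "inf (p + q) r \<le> r + q" "inf (p + q) r \<le> r + r"
    using assms by (auto intro!: le_infI2 simp: add_increasing add_increasing2)
  ultimately show ?thesis by simp
qed

lemma inf_sum_le:
  fixes f :: "'i \<Rightarrow> 'a::lattice_ab_group_add"
  assumes "0 \<le> r" "finite F" "\<And>i. i \<in> F \<Longrightarrow> 0 \<le> f i"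
  shows "inf r (\<Sum>i\<in>F. f i) \<le> (\<Sum>i\<in>F. inf r (f i))"
  using assms(2,3)
proof (induction F)
  case empty
  then show ?case by simp
next
  case (insert i F)
  have "inf r (\<Sum>j\<in>insert i F. f j) \<le> inf (f i) r + inf (\<Sum>j\<in>F. f j) r"
    using insert.hyps insert.prems inf_add_le[of "f i" "\<Sum>j\<in>F. f j" r] assms(1)
    by (simp add: inf_commute sum_nonneg)
  also have "\<dots> \<le> inf r (f i) + (\<Sum>j\<in>F. inf r (f j))"
    using insert.IH insert.prems by (simp add: inf_commute)
  finally show ?case using insert.hyps by simp
qed

lemma inf_eq_0_mono:
  fixes p q r :: "'a::lattice_ab_group_add"
  assumes "inf p r = 0" "0 \<le> q" "q \<le> p" "0 \<le> r"
  shows "inf q r = 0"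
  using assms inf_mono[OF assms(3) order_refl, of r] by (intro antisym) auto

text \<open>Rounding \<open>c\<close> up to a natural number \<open>n\<close> turns the multiple
  into a sum of \<open>n\<close> copies of \<open>a\<close>, each disjoint from \<open>b\<close>;
  disjointness passes down to the smaller \<open>c *\<^sub>R a\<close>.\<close>

lemma inf_scaleR_eq_0:
  fixes a b :: "'a::banach_lattice"
  assumes "inf a b = 0" "0 \<le> a" "0 \<le> b" "0 \<le> c"
  shows "inf (c *\<^sub>R a) b = 0"
proof -
  define n where "n = nat \<lceil>c\<rceil>"
  have nsum: "of_nat n *\<^sub>R a = (\<Sum>i<n. a)" by (simp add: sum_constant_scaleR)
  have "inf b (\<Sum>i<n. a) \<le> (\<Sum>i<n. inf b a)" using assms by (intro inf_sum_le) auto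
  then have "inf (real n *\<^sub>R a) b = 0"
    using assms nsum by (intro antisym) (auto simp: inf_commute intro!: sum_nonneg)
  moreover have "c *\<^sub>R a \<le> real n *\<^sub>R a"
    using assms by (intro scaleR_right_mono) (auto simp: n_def real_nat_ceiling_ge)
  ultimately show ?thesis
    using assms by (elim inf_eq_0_mono) (auto simp: scaleR_nonneg_nonneg)
qed

text \<open>By \<open>p + q = inf p q + sup p q\<close>, the sum of disjoint elements is their
  supremum.\<close>

lemma add_le_of_disjoint:
  fixes p q r :: "'a::lattice_ab_group_add"
  assumes "inf p q = 0" "p \<le> r" "q \<le> r"
  shows "p + q \<le> r"
  using assms add_eq_inf_sup[of p q] by simp

text \<open>If the net of finite partial sums were not Cauchy, one could pick disjoint finite blocks of
  norm at least \<open>e\<close>, and their increasing bounded partial sums would not converge.\<close>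

lemma kb_summable_on:
  fixes f :: "'i \<Rightarrow> 'e::kb_space"
  assumes nonneg: "\<And>i. i \<in> A \<Longrightarrow> 0 \<le> f i"
    and bd: "\<And>F. finite F \<Longrightarrow> F \<subseteq> A \<Longrightarrow> norm (sum f F) \<le> M"
  shows "f summable_on A"
proof -
  have small: "\<exists>F0. finite F0 \<and> F0 \<subseteq> A \<and>
      (\<forall>F. finite F \<and> F \<subseteq> A \<and> F \<inter> F0 = {} \<longrightarrow> norm (sum f F) < e)" if "0 < e" for e
  proof (rule ccontr)
    assume "\<not> ?thesis"
    then have "\<forall>F0. \<exists>F. finite F0 \<and> F0 \<subseteq> A \<longrightarrow>
        finite F \<and> F \<subseteq> A \<and> F \<inter> F0 = {} \<and> e \<le> norm (sum f F)"
      by (auto simp: not_less)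
    then obtain B where B: "\<And>F0. finite F0 \<Longrightarrow> F0 \<subseteq> A \<Longrightarrow>
        finite (B F0) \<and> B F0 \<subseteq> A \<and> B F0 \<inter> F0 = {} \<and> e \<le> norm (sum f (B F0))"
      by metis
    define G where "G n = ((\<lambda>F. F \<union> B F) ^^ n) {}" for n
    have G_Suc: "G (Suc n) = G n \<union> B (G n)" for n by (simp add: G_def)
    have G: "finite (G n) \<and> G n \<subseteq> A" for n
    proof (induction n)
      case (Suc n)
      then show ?case using B[of "G n"] by (simp add: G_Suc)
    qed (simp add: G_def)
    have BG: "finite (B (G n))" "B (G n) \<subseteq> A" "G n \<inter> B (G n) = {}" "e \<le> norm (sum f (B (G n)))" for n
      using B[of "G n"] G[of n] by auto
    define x where "x n = sum f (G n)" for n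
    have step: "x (Suc n) = x n + sum f (B (G n))" for n
      using G[of n] BG[of n] by (simp add: x_def G_Suc sum.union_disjoint)
    have "convergent x"
    proof (rule bounded_incseq_convergent)
      show "0 \<le> x n" for n unfolding x_def using G[of n] by (intro sum_nonneg nonneg) blast
      have "0 \<le> sum f (B (G n))" for n using BG(2)[of n] by (intro sum_nonneg nonneg) blast
      then show "x n \<le> x (Suc n)" for n by (simp add: step)
      have "norm (x n) \<le> M" for n unfolding x_def using G[of n] by (intro bd) auto
      then show "bounded (range x)" by (auto simp: bounded_iff)
    qed
    then obtain l where l: "x \<longlonglongrightarrow> l" by (auto simp: convergent_def)
    have "(\<lambda>n. x (Suc n) - x n) \<longlonglongrightarrow> l - l" by (intro tendsto_diff l LIMSEQ_Suc)
    then have "(\<lambda>n. norm (x (Suc n) - x n)) \<longlonglongrightarrow> norm (l - l)" by (rule tendsto_norm)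
    then have "e \<le> norm (l - l)" by (rule LIMSEQ_le_const) (simp add: step BG(4))
    then show False using \<open>0 < e\<close> by simp
  qed
  have "\<exists>P. eventually P (finite_subsets_at_top A) \<and>
      (\<forall>F1 F2. P F1 \<and> P F2 \<longrightarrow> dist (sum f F1) (sum f F2) < e)" if "0 < e" for e
  proof -
    from small[OF half_gt_zero[OF \<open>0 < e\<close>]] obtain F0 where F0: "finite F0" "F0 \<subseteq> A"
      "\<forall>F. finite F \<and> F \<subseteq> A \<and> F \<inter> F0 = {} \<longrightarrow> norm (sum f F) < e/2"
      by (elim exE conjE)
    let ?P = "\<lambda>F. finite F \<and> F0 \<subseteq> F \<and> F \<subseteq> A"
    have near: "dist (sum f F) (sum f F0) < e/2" if "?P F" for F
    proof -
      have "norm (sum f (F - F0)) < e/2" using that F0(3)[rule_format, of "F - F0"] by blast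
      then show ?thesis using that F0(1) by (simp add: sum_diff dist_norm)
    qed
    have "\<forall>F1 F2. ?P F1 \<and> ?P F2 \<longrightarrow> dist (sum f F1) (sum f F2) < e"
      by (intro allI impI) (elim conjE, rule dist_triangle_half_l[OF near near]; simp)
    moreover have "eventually ?P (finite_subsets_at_top A)"
      using F0(1,2) unfolding eventually_finite_subsets_at_top by blast
    ultimately show ?thesis by (intro exI[of _ ?P] conjI)
  qed
  \<comment> \<open>The limit is taken along the net of finite sets, so completeness enters through
    Cauchy filters instead of Cauchy sequences.\<close>
  then have "cauchy_filter (filtermap (sum f) (finite_subsets_at_top A))"
    by (simp add: cauchy_filter_metric_filtermap)
  moreover have "complete (UNIV :: 'e set)"
    by (meson Cauchy_convergent UNIV_I complete_def convergent_def)
  ultimately obtain l where "(sum f \<longlongrightarrow> l) (finite_subsets_at_top A)"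
    using complete_uniform[where S = "UNIV :: 'e set"] by (force simp: filterlim_def)
  then show ?thesis using summable_on_def has_sum_def by blast
qed

section \<open>Order bounds for unordered sums\<close>

lemma has_sum_nonneg_lattice:
  fixes f :: "'i \<Rightarrow> 'a::banach_lattice"
  assumes "(f has_sum s) A" "\<And>i. i \<in> A \<Longrightarrow> 0 \<le> f i"
  shows "0 \<le> s"
  using assms(1) unfolding has_sum_def
  by (rule le_limit_nonneg)
    (use assms(2) in \<open>auto simp: subset_iff intro!: eventually_finite_subsets_at_top_weakI sum_nonneg\<close>)

lemma has_sum_le_lattice:
  fixes f :: "'i \<Rightarrow> 'a::banach_lattice"
  assumes "(f has_sum s) A" "\<And>F. finite F \<Longrightarrow> F \<subseteq> A \<Longrightarrow> sum f F \<le> u"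
  shows "s \<le> u"
proof -
  have "((\<lambda>F. u - sum f F) \<longlongrightarrow> u - s) (finite_subsets_at_top A)"
    using assms(1) unfolding has_sum_def by (intro tendsto_intros)
  then have "0 \<le> u - s"
    by (rule le_limit_nonneg)
      (use assms(2) in \<open>auto intro!: eventually_finite_subsets_at_top_weakI\<close>)
  then show ?thesis by simp
qed

lemma sum_le_has_sum_lattice:
  fixes f :: "'i \<Rightarrow> 'a::banach_lattice"
  assumes s: "(f has_sum s) A" and nonneg: "\<And>i. i \<in> A \<Longrightarrow> 0 \<le> f i" and F: "finite F" "F \<subseteq> A"
  shows "sum f F \<le> s"
proof -
  have "(f has_sum (s - sum f F)) (A - F)"
    using has_sum_Diff[OF s has_sum_finite[OF F(1)] F(2)] .
  then have "0 \<le> s - sum f F" by (rule has_sum_nonneg_lattice) (use nonneg in auto)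
  then show ?thesis by simp
qed

section \<open>Coordinates with respect to atoms\<close>

text \<open>Normalization picks one representative on each ray of atoms, so that distinct members
  are disjoint and \<open>norm (c *\<^sub>R a)\<close> is \<open>\<bar>c\<bar>\<close>.\<close>

definition unit_atoms :: "'e::banach_lattice set" where
  "unit_atoms = {a. atom a \<and> norm a = 1}"

text \<open>Meaningful for \<open>0 \<le> x\<close> and \<open>a \<in> unit_atoms\<close> only.\<close>

definition coord :: "'e::banach_lattice \<Rightarrow> 'e \<Rightarrow> real" where
  "coord x a = Sup {c. 0 \<le> c \<and> c *\<^sub>R a \<le> x}"

lemma unit_atoms_pos: "a \<in> unit_atoms \<Longrightarrow> 0 < a"
  by (simp add: unit_atoms_def atom_def)

lemma scaleR_le_imp_le_norm:
  assumes "a \<in> unit_atoms" "0 \<le> c" "c *\<^sub>R a \<le> (x :: 'e::banach_lattice)"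
  shows "c \<le> norm x"
  using norm_mono_nonneg[OF _ assms(3)] assms unit_atoms_pos[OF assms(1)]
  by (simp add: unit_atoms_def scaleR_nonneg_nonneg less_imp_le)

lemma coord_bdd:
  assumes "a \<in> unit_atoms"
  shows "bdd_above {c. 0 \<le> c \<and> c *\<^sub>R a \<le> (x :: 'e::banach_lattice)}"
  using scaleR_le_imp_le_norm[OF assms] by (intro bdd_aboveI[of _ "norm x"]) auto

lemma le_coord:
  assumes "a \<in> unit_atoms" "0 \<le> c" "c *\<^sub>R a \<le> (x :: 'e::banach_lattice)"
  shows "c \<le> coord x a"
  unfolding coord_def using assms coord_bdd by (intro cSup_upper) auto

lemma coord_le:
  assumes "0 \<le> x" "\<And>c. 0 \<le> c \<Longrightarrow> c *\<^sub>R a \<le> (x :: 'e::banach_lattice) \<Longrightarrow> c \<le> m"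
  shows "coord x a \<le> m"
  unfolding coord_def using assms by (intro cSup_least) (auto intro: exI[of _ 0])

lemma coord_nonneg:
  assumes "a \<in> unit_atoms" "0 \<le> (x :: 'e::banach_lattice)"
  shows "0 \<le> coord x a"
  using assms by (intro le_coord) auto

lemma coord_le_norm:
  assumes "a \<in> unit_atoms" "0 \<le> (x :: 'e::banach_lattice)"
  shows "coord x a \<le> norm x"
  using assms scaleR_le_imp_le_norm by (intro coord_le) auto

text \<open>The supremum defining \<open>coord\<close> is attained: admissible coefficients
  approximate it, and the positive cone is closed.\<close>

lemma coord_scaleR_le:
  assumes a: "a \<in> unit_atoms" and x: "0 \<le> (x :: 'e::banach_lattice)"
  shows "coord x a *\<^sub>R a \<le> x"
proof -
  let ?S = "{c. 0 \<le> c \<and> c *\<^sub>R a \<le> x}"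
  have "coord x a \<in> closure ?S"
    unfolding coord_def using x coord_bdd[OF a]
    by (intro closure_contains_Sup) (auto intro: exI[of _ 0])
  then obtain c where c: "\<And>n. c n \<in> ?S" "c \<longlonglongrightarrow> coord x a" by (auto simp: closure_sequential)
  have "(\<lambda>n. x - c n *\<^sub>R a) \<longlonglongrightarrow> x - coord x a *\<^sub>R a" by (intro tendsto_intros c)
  then have "0 \<le> x - coord x a *\<^sub>R a" by (rule le_limit_nonneg) (use c(1) in auto)
  then show ?thesis by simp
qed

text \<open>The infimum lies below the atom, hence is \<open>c *\<^sub>R a\<close> for some
  \<open>c\<close>. A positive \<open>c\<close> could be added to the coordinate, against its
  maximality.\<close>

lemma coord_remainder_disjoint:
  assumes a: "a \<in> unit_atoms" and x: "0 \<le> (x :: 'e::banach_lattice)"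
  shows "inf (x - coord x a *\<^sub>R a) a = 0"
proof -
  let ?y = "x - coord x a *\<^sub>R a"
  have a0: "0 < a" and atom: "atom a" using a by (auto simp: unit_atoms_def atom_def)
  have y: "0 \<le> ?y" using coord_scaleR_le[OF a x] by simp
  have i: "0 \<le> inf ?y a" "inf ?y a \<le> a" using y a0 by auto
  then obtain c where c: "inf ?y a = c *\<^sub>R a" using atom unfolding atom_def by blast
  have "c \<le> 0"
  proof (rule ccontr)
    assume "\<not> c \<le> 0"
    then have "0 < c" by simp
    have "c *\<^sub>R a \<le> ?y" using c by (metis inf_le1)
    then have "(coord x a + c) *\<^sub>R a \<le> x" by (simp add: scaleR_add_left le_diff_eq add.commute)
    then have "coord x a + c \<le> coord x a"
      using a \<open>0 < c\<close> coord_nonneg[OF a x] by (intro le_coord) auto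
    with \<open>0 < c\<close> show False by simp
  qed
  then have "c *\<^sub>R a \<le> 0" using a0 by (simp add: scaleR_nonpos_nonneg)
  with c i(1) show ?thesis by simp
qed

text \<open>Converse of \<open>coord_remainder_disjoint\<close>. An admissible \<open>d > c\<close>
  would put the nonzero \<open>(d - c) *\<^sub>R a\<close> below \<open>y\<close>, yet it is
  disjoint from \<open>y\<close>.\<close>

lemma coord_eqI:
  assumes a: "a \<in> unit_atoms" and c: "0 \<le> c" and y: "0 \<le> y" "inf y a = 0"
  shows "coord (c *\<^sub>R a + y :: 'e::banach_lattice) a = c"
proof (rule antisym)
  have a0: "0 \<le> a" using unit_atoms_pos[OF a] by simp
  show "c \<le> coord (c *\<^sub>R a + y) a" using a c y by (intro le_coord) auto
  show "coord (c *\<^sub>R a + y) a \<le> c"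
  proof (rule coord_le)
    show "0 \<le> c *\<^sub>R a + y" using c a0 y by (simp add: scaleR_nonneg_nonneg)
  next
    fix d assume d: "0 \<le> d" "d *\<^sub>R a \<le> c *\<^sub>R a + y"
    show "d \<le> c"
    proof (rule ccontr)
      assume "\<not> d \<le> c"
      then have dc: "0 \<le> d - c" by simp
      have le: "(d - c) *\<^sub>R a \<le> y" using d(2) by (simp add: scaleR_diff_left algebra_simps)
      have "inf ((d - c) *\<^sub>R a) y = 0"
        using a0 y dc by (intro inf_scaleR_eq_0) (auto simp: inf_commute)
      with le have "(d - c) *\<^sub>R a = 0" by (simp add: inf_absorb1)
      with \<open>\<not> d \<le> c\<close> unit_atoms_pos[OF a] show False by simp
    qed
  qed
qed

text \<open>A nonzero \<open>inf a b\<close> is a multiple of both atoms. Its two coefficients are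
  positive and, since \<open>a\<close> and \<open>b\<close> have norm 1, equal, which forces
  \<open>a = b\<close>.\<close>

lemma unit_atoms_disjoint:
  assumes a: "a \<in> unit_atoms" and b: "b \<in> unit_atoms" and ne: "a \<noteq> (b :: 'e::banach_lattice)"
  shows "inf a b = 0"
proof (rule ccontr)
  assume n0: "inf a b \<noteq> 0"
  have pos: "0 < a" "0 < b" using a b unit_atoms_pos by auto
  then have i: "0 \<le> inf a b" "inf a b \<le> a" "inf a b \<le> b" by auto
  then obtain c d where cd: "inf a b = c *\<^sub>R a" "inf a b = d *\<^sub>R b"
    using a b unfolding unit_atoms_def atom_def by blast
  have "\<bar>c\<bar> = norm (inf a b)" "\<bar>d\<bar> = norm (inf a b)"
    using a b arg_cong[OF cd(1), of norm] arg_cong[OF cd(2), of norm]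
    by (simp_all add: unit_atoms_def)
  then have abs: "\<bar>c\<bar> = \<bar>d\<bar>" by simp
  have "c \<noteq> 0" "d \<noteq> 0" using n0 cd by auto
  have npos: "0 < c" if "0 \<le> c *\<^sub>R z" "0 < z" "c \<noteq> 0" for c and z :: 'e
  proof (rule ccontr)
    assume "\<not> 0 < c"
    then have "c *\<^sub>R z \<le> 0" using that by (intro scaleR_nonpos_nonneg) auto
    then have "c *\<^sub>R z = 0" using that by simp
    then show False using that by simp
  qed
  have "0 < c" "0 < d" using npos cd i(1) pos \<open>c \<noteq> 0\<close> \<open>d \<noteq> 0\<close> by metis+
  with abs have "c = d" by simp
  with cd \<open>d \<noteq> 0\<close> ne show False by (metis scaleR_left_imp_eq)
qed

text \<open>Each component lies below \<open>x\<close>, and components along distinct atoms are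
  disjoint, so adding one more component amounts to taking a supremum of two elements below
  \<open>x\<close>.\<close>

lemma sum_coord_le:
  assumes x: "0 \<le> (x :: 'e::banach_lattice)" and F: "finite F" "F \<subseteq> unit_atoms"
  shows "(\<Sum>a\<in>F. coord x a *\<^sub>R a) \<le> x"
  using F
proof (induction F)
  case empty
  then show ?case using x by simp
next
  case (insert b F)
  let ?f = "\<lambda>a. coord x a *\<^sub>R a"
  have b: "b \<in> unit_atoms" "0 \<le> b" using insert.prems unit_atoms_pos by (auto intro: less_imp_le)
  have nn: "0 \<le> ?f a" if "a \<in> insert b F" for a
    using that insert.prems coord_nonneg[of a x] x unit_atoms_pos[of a]
    by (auto intro!: scaleR_nonneg_nonneg simp: less_imp_le)
  have "inf (?f a) (?f b) = 0" if "a \<in> F" for a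
  proof -
    have a: "a \<in> unit_atoms" "0 \<le> a" "a \<noteq> b"
      using that insert unit_atoms_pos by (auto intro: less_imp_le)
    have "inf (?f a) b = 0"
      using a b x by (intro inf_scaleR_eq_0 unit_atoms_disjoint coord_nonneg)
    then have "inf (?f b) (?f a) = 0"
      using that b x nn[of a] by (intro inf_scaleR_eq_0 coord_nonneg) (auto simp: inf_commute)
    then show ?thesis by (simp add: inf_commute)
  qed
  then have "inf (?f b) (\<Sum>a\<in>F. ?f a) \<le> (\<Sum>a\<in>F. 0)"
    using inf_sum_le[of "?f b" F ?f] nn insert.hyps by (simp add: inf_commute)
  then have "inf (?f b) (\<Sum>a\<in>F. ?f a) = 0"
    using nn by (intro antisym) (auto intro!: sum_nonneg)
  moreover have "?f b \<le> x" using coord_scaleR_le[OF b(1) x] .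
  ultimately have "?f b + (\<Sum>a\<in>F. ?f a) \<le> x"
    using insert by (intro add_le_of_disjoint) auto
  then show ?case using insert.hyps by simp
qed

text \<open>Write \<open>s\<close> as \<open>c b *\<^sub>R b + t\<close> with \<open>t\<close> the
  sum over the other atoms. Finite partial sums of \<open>t\<close> are disjoint from
  \<open>b\<close> and the rest has arbitrarily small norm, so \<open>inf t b = 0\<close> and
  \<open>coord_eqI\<close> applies.\<close>

lemma has_sum_atoms_coord:
  fixes s :: "'e::banach_lattice"
  assumes s: "((\<lambda>a. c a *\<^sub>R a) has_sum s) unit_atoms"
    and c: "\<And>a. a \<in> unit_atoms \<Longrightarrow> 0 \<le> c a" and b: "b \<in> unit_atoms"
  shows "coord s b = c b"
proof -
  let ?f = "\<lambda>a. c a *\<^sub>R a"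
  have pos: "0 \<le> a" if "a \<in> unit_atoms" for a :: 'e using unit_atoms_pos[OF that] by simp
  have nn: "0 \<le> ?f a" if "a \<in> unit_atoms" for a
    using that c pos by (intro scaleR_nonneg_nonneg)
  define t where "t = s - ?f b"
  have "(?f has_sum (s - sum ?f {b})) (unit_atoms - {b})"
    using b by (intro has_sum_Diff s has_sum_finite) auto
  then have t: "(?f has_sum t) (unit_atoms - {b})" by (simp add: t_def)
  have t0: "0 \<le> t" using t by (rule has_sum_nonneg_lattice) (use nn in auto)
  have "norm (inf t b) \<le> e" if "0 < e" for e
  proof -
    obtain F where F: "finite F" "F \<subseteq> unit_atoms - {b}" "dist (sum ?f F) t \<le> e"
      using has_sum_finite_approximation[OF t \<open>0 < e\<close>] by blast
    have le: "sum ?f F \<le> t" using t by (rule sum_le_has_sum_lattice) (use nn F in auto)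
    have F0: "0 \<le> sum ?f F" using nn F(2) by (intro sum_nonneg) auto
    have "inf b (sum ?f F) \<le> (\<Sum>a\<in>F. inf b (?f a))"
      using pos b F nn by (intro inf_sum_le) auto
    also have "\<dots> = (\<Sum>a\<in>F. 0)"
    proof (rule sum.cong)
      fix a assume "a \<in> F"
      then have a: "a \<in> unit_atoms" "a \<noteq> b" using F by auto
      then have "inf (?f a) b = 0"
        using b pos c by (intro inf_scaleR_eq_0 unit_atoms_disjoint) auto
      then show "inf b (?f a) = 0" by (simp add: inf_commute)
    qed simp
    finally have F_b: "inf (sum ?f F) b \<le> 0" by (simp add: inf_commute)
    have "inf t b = inf (sum ?f F + (t - sum ?f F)) b" by simp
    also have "\<dots> \<le> inf (sum ?f F) b + inf (t - sum ?f F) b"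
      using F0 le pos[OF b] by (intro inf_add_le) auto
    also have "\<dots> \<le> 0 + (t - sum ?f F)" using F_b by (intro add_mono) auto
    finally have "norm (inf t b) \<le> norm (t - sum ?f F)"
      using t0 pos[OF b] by (intro norm_mono_nonneg) auto
    then show ?thesis using F(3) by (simp add: dist_norm norm_minus_commute)
  qed
  then have "norm (inf t b) \<le> 0" by (rule field_le_epsilon[of _ 0, simplified])
  then have "inf t b = 0" by simp
  then have "coord (c b *\<^sub>R b + t) b = c b" using b c t0 by (intro coord_eqI) auto
  then show ?thesis by (simp add: t_def)
qed

lemma coord_summable:
  assumes "0 \<le> (x :: 'e::kb_space)"
  shows "(\<lambda>a. coord x a *\<^sub>R a) summable_on unit_atoms"
proof (rule kb_summable_on)
  show nn: "0 \<le> coord x a *\<^sub>R a" if "a \<in> unit_atoms" for a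
    using that coord_nonneg[OF that assms] unit_atoms_pos[OF that]
    by (simp add: scaleR_nonneg_nonneg)
  show "norm (\<Sum>a\<in>F. coord x a *\<^sub>R a) \<le> norm x" if "finite F" "F \<subseteq> unit_atoms" for F
    using that nn sum_coord_le[OF assms that] by (intro norm_mono_nonneg sum_nonneg) auto
qed

text \<open>The components have a sum \<open>s <= x\<close> with the same coordinates as
  \<open>x\<close>. Were \<open>s < x\<close>, an atom below \<open>x - s\<close> could be added to
  the component of \<open>s\<close> along it, exceeding the maximal coefficient for
  \<open>x\<close>.\<close>

lemma atomic_has_sum_coord:
  assumes x: "0 \<le> (x :: 'e::{kb_space, atomic_banach_lattice})"
  shows "((\<lambda>a. coord x a *\<^sub>R a) has_sum x) unit_atoms"
proof -
  let ?f = "\<lambda>a. coord x a *\<^sub>R a"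
  obtain s where s: "(?f has_sum s) unit_atoms"
    using coord_summable[OF x] by (auto simp: summable_on_def)
  have "s \<le> x" using s by (rule has_sum_le_lattice) (rule sum_coord_le[OF x])
  moreover have "\<not> s < x"
  proof
    assume "s < x"
    then obtain a where a: "atom a" "a \<le> x - s" using atom_below[of "x - s"] by auto
    then have "0 < a" by (simp add: atom_def)
    \<comment> \<open>The atom found need not have norm 1; its normalization is again an atom, and
      \<open>a\<close> is \<open>norm a\<close> times it.\<close>
    define b where "b = a /\<^sub>R norm a"
    have "0 < norm a" using \<open>0 < a\<close> by auto
    have ab: "a = norm a *\<^sub>R b" using \<open>0 < norm a\<close> by (simp add: b_def)
    have "0 \<le> b" using \<open>0 < a\<close> by (simp add: b_def scaleR_nonneg_nonneg)
    have "atom b"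
      unfolding atom_def
    proof (intro conjI allI impI)
      show "0 < b" using \<open>0 \<le> b\<close> ab \<open>0 < a\<close> by (metis less_le scaleR_zero_right)
      fix y assume y: "0 \<le> y \<and> y \<le> b"
      then have "0 \<le> norm a *\<^sub>R y \<and> norm a *\<^sub>R y \<le> a"
        using ab scaleR_left_mono[of y b "norm a"] by (simp add: scaleR_nonneg_nonneg)
      then obtain c where "norm a *\<^sub>R y = c *\<^sub>R a" using a(1) unfolding atom_def by blast
      also have "\<dots> = norm a *\<^sub>R (c *\<^sub>R b)" using ab by (metis scaleR_left_commute)
      finally have "y = c *\<^sub>R b" using \<open>0 < norm a\<close> by (metis less_irrefl scaleR_left_imp_eq)
      then show "\<exists>c. y = c *\<^sub>R b" ..
    qed
    then have b: "b \<in> unit_atoms" using \<open>0 < norm a\<close> by (simp add: unit_atoms_def b_def)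
    have cs: "coord s b = coord x b"
      using s b coord_nonneg x by (intro has_sum_atoms_coord) auto
    have s0: "0 \<le> s" using s
      by (rule has_sum_nonneg_lattice) (intro scaleR_nonneg_nonneg coord_nonneg[OF _ x] less_imp_le[OF unit_atoms_pos])
    have "coord x b *\<^sub>R b \<le> s" using coord_scaleR_le[OF b s0] cs by simp
    then have "coord x b *\<^sub>R b + norm a *\<^sub>R b \<le> s + (x - s)"
      using a(2) ab by (intro add_mono) auto
    then have "(coord x b + norm a) *\<^sub>R b \<le> x" by (simp add: scaleR_add_left)
    then have "coord x b + norm a \<le> coord x b"
      using b coord_nonneg[OF b x] by (intro le_coord) auto
    with \<open>0 < norm a\<close> show False by simp
  qed
  ultimately have "s = x" by simp
  with s show ?thesis by simp
qed

section \<open>Unbounded convergence in atomic KB-spaces\<close>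

text \<open>Up to the coordinate difference along \<open>a\<close>, the modulus of
  \<open>x - l\<close> is bounded by the sum of the two remainders, which are disjoint from
  \<open>a\<close> and vanish under truncation by a multiple of \<open>a\<close>. The bound does not
  involve \<open>d\<close>.\<close>

lemma inf_abs_diff_atom_le:
  fixes x l :: "'e::banach_lattice"
  assumes a: "a \<in> unit_atoms" and x: "0 \<le> x" and l: "0 \<le> l" and d: "0 \<le> d"
  shows "inf \<bar>x - l\<bar> (d *\<^sub>R a) \<le> \<bar>coord x a - coord l a\<bar> *\<^sub>R a"
proof -
  have a0: "0 \<le> a" using unit_atoms_pos[OF a] by simp
  define x' l' where "x' = x - coord x a *\<^sub>R a" and "l' = l - coord l a *\<^sub>R a"
  define c where "c = \<bar>coord x a - coord l a\<bar>"
  have pos: "0 \<le> x'" "0 \<le> l'" "0 \<le> c *\<^sub>R a" "0 \<le> d *\<^sub>R a"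
    using coord_scaleR_le[OF a x] coord_scaleR_le[OF a l] a0 d
    by (simp_all add: x'_def l'_def c_def scaleR_nonneg_nonneg)
  have disj: "inf y (d *\<^sub>R a) = 0" if "0 \<le> y" "inf y a = 0" for y
    using inf_scaleR_eq_0[of a y d] that a0 d by (simp add: inf_commute)
  have inf0: "inf x' (d *\<^sub>R a) = 0" "inf l' (d *\<^sub>R a) = 0"
    using disj[OF pos(1)] disj[OF pos(2)] coord_remainder_disjoint[OF a x]
      coord_remainder_disjoint[OF a l]
    by (simp_all add: x'_def l'_def)
  have diff: "x - l = (coord x a - coord l a) *\<^sub>R a + (x' - l')"
    by (simp add: x'_def l'_def scaleR_diff_left)
  have "(coord x a - coord l a) *\<^sub>R a \<le> c *\<^sub>R a" "- ((coord x a - coord l a) *\<^sub>R a) \<le> c *\<^sub>R a"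
    using a0 scaleR_right_mono[of "coord x a - coord l a" c a]
      scaleR_right_mono[of "- (coord x a - coord l a)" c a]
    unfolding c_def scaleR_minus_left by (simp_all add: abs_ge_minus_self)
  moreover have "x' - l' \<le> x' + l'" "- (x' - l') \<le> x' + l'"
    using pos by (simp_all add: diff_le_eq le_diff_eq add_increasing add_increasing2)
  ultimately have "\<bar>x - l\<bar> \<le> c *\<^sub>R a + (x' + l')"
    unfolding diff by (intro abs_leI) (simp_all only: minus_add_distrib add_mono)
  then have "inf \<bar>x - l\<bar> (d *\<^sub>R a) \<le> inf (c *\<^sub>R a + (x' + l')) (d *\<^sub>R a)"
    by (rule inf_mono) simp
  also have "\<dots> \<le> inf (c *\<^sub>R a) (d *\<^sub>R a) + inf (x' + l') (d *\<^sub>R a)"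
    using pos by (intro inf_add_le) auto
  also have "\<dots> \<le> c *\<^sub>R a + (inf x' (d *\<^sub>R a) + inf l' (d *\<^sub>R a))"
    using pos by (intro add_mono inf_add_le inf_le1) auto
  finally show ?thesis using inf0 by (simp add: c_def)
qed

lemma coordwise_imp_unbounded_norm_convergence:
  fixes x :: "nat \<Rightarrow> 'e::{kb_space, atomic_banach_lattice}"
  assumes x: "\<And>n. 0 \<le> x n" and l: "0 \<le> l"
    and lim: "\<And>a. a \<in> unit_atoms \<Longrightarrow> (\<lambda>n. coord (x n) a) \<longlonglongrightarrow> coord l a"
    and u: "0 \<le> u"
  shows "(\<lambda>n. inf \<bar>x n - l\<bar> u) \<longlonglongrightarrow> 0"
proof (rule LIMSEQ_I)
  fix e :: real assume "0 < e"
  let ?f = "\<lambda>a. coord u a *\<^sub>R a"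
  have pos: "0 \<le> a" if "a \<in> unit_atoms" for a :: 'e using unit_atoms_pos[OF that] by simp
  obtain F where F: "finite F" "F \<subseteq> unit_atoms" "dist (sum ?f F) u \<le> e/2"
    using has_sum_finite_approximation[OF atomic_has_sum_coord[OF u], of "e/2"] \<open>0 < e\<close> by auto
  have f0: "0 \<le> ?f a" if "a \<in> F" for a
    using that F(2) pos coord_nonneg[OF _ u] by (intro scaleR_nonneg_nonneg) auto
  have F_le: "sum ?f F \<le> u" using sum_coord_le[OF u F(1,2)] .
  let ?g = "\<lambda>n. \<Sum>a\<in>F. \<bar>coord (x n) a - coord l a\<bar>"
  \<comment> \<open>Truncation by \<open>u\<close> splits into truncation by the finite part,
    estimated atom by atom through the coordinate differences, and by the rest of \<open>u\<close>,
    which contributes at most \<open>e/2\<close> for every \<open>n\<close>.\<close>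
  have bound: "norm (inf \<bar>x n - l\<bar> u) \<le> ?g n + e/2" for n
  proof -
    have "inf \<bar>x n - l\<bar> u = inf (sum ?f F + (u - sum ?f F)) \<bar>x n - l\<bar>"
      by (simp add: inf_commute)
    also have "\<dots> \<le> inf (sum ?f F) \<bar>x n - l\<bar> + inf (u - sum ?f F) \<bar>x n - l\<bar>"
      using F_le f0 by (intro inf_add_le sum_nonneg) auto
    also have "\<dots> \<le> (\<Sum>a\<in>F. inf \<bar>x n - l\<bar> (?f a)) + (u - sum ?f F)"
      using inf_sum_le[of "\<bar>x n - l\<bar>" F ?f] F(1) f0 by (intro add_mono) (auto simp: inf_commute)
    also have "\<dots> \<le> (\<Sum>a\<in>F. \<bar>coord (x n) a - coord l a\<bar> *\<^sub>R a) + (u - sum ?f F)"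
      using F(2) x l coord_nonneg[OF _ u]
      by (intro add_right_mono sum_mono inf_abs_diff_atom_le) auto
    finally have "norm (inf \<bar>x n - l\<bar> u)
        \<le> norm ((\<Sum>a\<in>F. \<bar>coord (x n) a - coord l a\<bar> *\<^sub>R a) + (u - sum ?f F))"
      using u by (intro norm_mono_nonneg) auto
    also have "\<dots> \<le> (\<Sum>a\<in>F. norm (\<bar>coord (x n) a - coord l a\<bar> *\<^sub>R a)) + norm (u - sum ?f F)"
      by (intro norm_triangle_le add_right_mono norm_sum)
    also have "(\<Sum>a\<in>F. norm (\<bar>coord (x n) a - coord l a\<bar> *\<^sub>R a)) = ?g n"
      using F(2) by (intro sum.cong) (auto simp: unit_atoms_def)
    also have "norm (u - sum ?f F) \<le> e/2" using F(3) by (simp add: dist_norm norm_minus_commute)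
    finally show ?thesis by simp
  qed
  have "?g \<longlonglongrightarrow> (\<Sum>a\<in>F. \<bar>coord l a - coord l a\<bar>)"
    using F(2) by (intro tendsto_intros lim) auto
  then have "?g \<longlonglongrightarrow> 0" by simp
  then obtain N where N: "\<forall>n\<ge>N. norm (?g n - 0) < e/2"
    using LIMSEQ_D[of ?g 0 "e/2"] \<open>0 < e\<close> by auto
  show "\<exists>N. \<forall>n\<ge>N. norm (inf \<bar>x n - l\<bar> u - 0) < e"
  proof (intro exI[of _ N] allI impI)
    fix n assume "n \<ge> N"
    then have "norm (?g n - 0) < e/2" using N by blast
    then have "?g n < e/2" by (simp add: abs_less_iff)
    with bound[of n] show "norm (inf \<bar>x n - l\<bar> u - 0) < e" by simp
  qed
qed

section \<open>Extraction of coordinatewise convergent subsequences\<close>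

lemma countable_coord_support:
  assumes x: "0 \<le> (x :: 'e::{kb_space, atomic_banach_lattice})"
  shows "countable {a \<in> unit_atoms. 0 < coord x a}"
proof -
  let ?f = "\<lambda>a. coord x a *\<^sub>R a"
  \<comment> \<open>Take a finite partial sum within \<open>e\<close> of \<open>x\<close>. The
    component along any atom outside \<open>F\<close> fits below the remainder, so its coefficient
    is at most \<open>e\<close>.\<close>
  have fin: "finite {a \<in> unit_atoms. e < coord x a}" if "0 < e" for e
  proof -
    obtain F where F: "finite F" "F \<subseteq> unit_atoms" "dist (sum ?f F) x \<le> e"
      using has_sum_finite_approximation[OF atomic_has_sum_coord[OF x] \<open>0 < e\<close>] by auto
    have "coord x a \<le> e" if a: "a \<in> unit_atoms" "a \<notin> F" for a
    proof -
      have "sum ?f (insert a F) \<le> x" using a F by (intro sum_coord_le[OF x]) auto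
      then have "?f a \<le> x - sum ?f F" using a F by (simp add: le_diff_eq)
      then have "coord x a \<le> norm (x - sum ?f F)"
        by (rule scaleR_le_imp_le_norm[OF a(1) coord_nonneg[OF a(1) x]])
      with F(3) show ?thesis by (simp add: dist_norm norm_minus_commute)
    qed
    then have "{a \<in> unit_atoms. e < coord x a} \<subseteq> F" by force
    with F(1) show ?thesis by (rule finite_subset[rotated])
  qed
  have "{a \<in> unit_atoms. 0 < coord x a} \<subseteq> (\<Union>n. {a \<in> unit_atoms. inverse (real (Suc n)) < coord x a})"
    using reals_Archimedean by fastforce
  moreover have "countable (\<Union>n. {a \<in> unit_atoms. inverse (real (Suc n)) < coord x a})"
    by (rule countable_UN) (auto intro!: countable_finite fin)
  ultimately show ?thesis by (rule countable_subset)
qed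

lemma bounded_functions_convergent_subseq:
  fixes y :: "nat \<Rightarrow> nat \<Rightarrow> real"
  assumes "\<And>n k. y n k \<in> {a..b}"
  obtains r where "strict_mono r" "\<And>k. convergent (\<lambda>n. y (r n) k)"
proof -
  \<comment> \<open>The diagonal argument in topological form: the cube is compact by Tychonoff, and
    a countable product of real lines is metrizable, so compactness is sequential.\<close>
  have "compactin (product_topology (\<lambda>_. euclidean) UNIV) (PiE UNIV (\<lambda>_ :: nat. {a..b}))"
    unfolding compactin_PiE by simp
  then have "compact (PiE UNIV (\<lambda>_ :: nat. {a..b}))"
    by (simp add: euclidean_product_topology)
  then have "seq_compact (PiE UNIV (\<lambda>_ :: nat. {a..b}))"
    by (simp add: compact_eq_seq_compact_metric)
  moreover have "\<forall>n. y n \<in> PiE UNIV (\<lambda>_. {a..b})" using assms by (simp add: PiE_def)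
  ultimately obtain l r where r: "strict_mono r" "(y \<circ> r) \<longlonglongrightarrow> l"
    using seq_compactE by blast
  have "(\<lambda>n. (y \<circ> r) n k) \<longlonglongrightarrow> l k" for k
    by (rule continuous_on_tendsto_compose[OF continuous_on_product_coordinates r(2)]) auto
  then have "convergent (\<lambda>n. y (r n) k)" for k by (auto simp: convergent_def)
  then show ?thesis by (rule that[OF r(1)])
qed

lemma nonneg_bounded_coordwise_convergent_subseq:
  fixes x :: "nat \<Rightarrow> 'e::{kb_space, atomic_banach_lattice}"
  assumes x: "\<And>n. 0 \<le> x n" and M: "\<And>n. norm (x n) \<le> M"
  obtains r l where "strict_mono r" "0 \<le> l"
    "\<forall>a\<in>unit_atoms. (\<lambda>n. coord (x (r n)) a) \<longlonglongrightarrow> coord l a"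
proof -
  \<comment> \<open>Along atoms outside \<open>C\<close> every coordinate of every
    \<open>x n\<close> is 0, so only the countably many atoms in \<open>C\<close> need an
    extraction.\<close>
  define C where "C = (\<Union>n. {a \<in> unit_atoms. 0 < coord (x n) a})"
  have "countable C" unfolding C_def by (intro countable_UN countable_coord_support x) simp
  then obtain e :: "nat \<Rightarrow> 'e" where e: "C \<subseteq> range e"
    by (metis empty_subsetI order_refl range_from_nat_into)
  \<comment> \<open>The enumeration \<open>e\<close> covers \<open>C\<close> but may take values
    that are not unit atoms; the default 0 keeps \<open>y\<close> in the cube there.\<close>
  define y where "y n k = (if e k \<in> unit_atoms then coord (x n) (e k) else 0)" for n k
  have "0 \<le> M" using M[of 0] norm_ge_zero order_trans by blast
  have cM: "coord (x n) a \<le> M" if "a \<in> unit_atoms" for a n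
    using coord_le_norm[OF that x] M order_trans by blast
  have "y n k \<in> {0..M}" for n k
    using coord_nonneg[OF _ x] cM \<open>0 \<le> M\<close> by (simp add: y_def)
  then obtain r where r: "strict_mono r" "\<And>k. convergent (\<lambda>n. y (r n) k)"
    using bounded_functions_convergent_subseq by blast
  define \<mu> where "\<mu> a = lim (\<lambda>n. coord (x (r n)) a)" for a
  have \<mu>: "(\<lambda>n. coord (x (r n)) a) \<longlonglongrightarrow> \<mu> a" if a: "a \<in> unit_atoms" for a
  proof -
    have "convergent (\<lambda>n. coord (x (r n)) a)"
    proof (cases "a \<in> C")
      case True
      then obtain k where "a = e k" using e by auto
      with r(2)[of k] a show ?thesis by (simp add: y_def)
    next
      case False
      then have "coord (x n) a = 0" for n
        using a coord_nonneg[OF a x, of n] by (auto simp: C_def not_less intro: antisym)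
      then show ?thesis by (simp add: convergent_const)
    qed
    then show ?thesis by (simp add: \<mu>_def convergent_LIMSEQ_iff)
  qed
  have \<mu>0: "0 \<le> \<mu> a" if "a \<in> unit_atoms" for a
    using \<mu>[OF that] by (rule LIMSEQ_le_const) (use coord_nonneg[OF that x] in auto)
  have nn: "0 \<le> \<mu> a *\<^sub>R a" if "a \<in> unit_atoms" for a
    using \<mu>0[OF that] unit_atoms_pos[OF that] by (simp add: scaleR_nonneg_nonneg)
  \<comment> \<open>The partial sums for each \<open>x n\<close> lie between 0 and
    \<open>x n\<close>, hence have norm at most \<open>M\<close>; this passes to the limit and lets
    the KB property sum the limit coordinates.\<close>
  have \<mu>M: "norm (\<Sum>a\<in>F. \<mu> a *\<^sub>R a) \<le> M" if F: "finite F" "F \<subseteq> unit_atoms" for F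
  proof (rule LIMSEQ_le_const2)
    show "(\<lambda>n. norm (\<Sum>a\<in>F. coord (x (r n)) a *\<^sub>R a)) \<longlonglongrightarrow> norm (\<Sum>a\<in>F. \<mu> a *\<^sub>R a)"
      using F by (intro tendsto_intros \<mu>) auto
    have "norm (\<Sum>a\<in>F. coord (x n) a *\<^sub>R a) \<le> M" for n
    proof -
      have "0 \<le> coord (x n) a *\<^sub>R a" if "a \<in> F" for a
        using that F(2) by (intro scaleR_nonneg_nonneg coord_nonneg x less_imp_le[OF unit_atoms_pos]) auto
      then have "norm (\<Sum>a\<in>F. coord (x n) a *\<^sub>R a) \<le> norm (x n)"
        by (intro norm_mono_nonneg sum_nonneg sum_coord_le x F)
      then show ?thesis using M[of n] by linarith
    qed
    then show "\<exists>N. \<forall>n\<ge>N. norm (\<Sum>a\<in>F. coord (x (r n)) a *\<^sub>R a) \<le> M" by blast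
  qed
  have "(\<lambda>a. \<mu> a *\<^sub>R a) summable_on unit_atoms" using nn \<mu>M by (rule kb_summable_on)
  then obtain l where l: "((\<lambda>a. \<mu> a *\<^sub>R a) has_sum l) unit_atoms" by (auto simp: summable_on_def)
  have "coord l a = \<mu> a" if "a \<in> unit_atoms" for a
    using l \<mu>0 that by (rule has_sum_atoms_coord)
  moreover have "0 \<le> l" using l nn by (rule has_sum_nonneg_lattice)
  ultimately show ?thesis using that[OF r(1), of l] \<mu> by simp
qed

lemma norm_tendsto_imp_weakly_tendsto: "x \<longlonglongrightarrow> l \<Longrightarrow> weakly_tendsto x l"
  by (simp add: weakly_tendsto_def bounded_linear.tendsto)

text \<open>Positive and negative parts are handled in turn, the second extraction running inside
  the first. The truncated modulus of the difference is at most the sum of those of the two parts,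
  so the convergence holds even in norm.\<close>

lemma bounded_uaw_convergent_subseq:
  fixes x :: "nat \<Rightarrow> 'e::{kb_space, atomic_banach_lattice}"
  assumes "bounded (range x)"
  obtains r l where "strict_mono r" "uaw_tendsto (x \<circ> r) l"
proof -
  obtain M where M: "\<And>n. norm (x n) \<le> M" using assms by (auto simp: bounded_iff)
  define p q where "p n = pprt (x n)" and "q n = - nprt (x n)" for n
  have pq: "0 \<le> p n" "0 \<le> q n" "x n = p n - q n" "\<bar>x n\<bar> = p n + q n" for n
    using prts[of "x n"] by (simp_all add: p_def q_def abs_prts)
  have "norm (p n) \<le> norm \<bar>x n\<bar>" "norm (q n) \<le> norm \<bar>x n\<bar>" for n
    using pq(1,2)[of n] unfolding pq(4) by (auto intro!: norm_mono_nonneg)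
  then have pM: "norm (p n) \<le> M" and qM: "norm (q n) \<le> M" for n
    using M[of n] by (metis norm_abs_banach_lattice order_trans)+
  obtain r1 l1 where 1: "strict_mono r1" "0 \<le> l1"
    "\<forall>a\<in>unit_atoms. (\<lambda>n. coord (p (r1 n)) a) \<longlonglongrightarrow> coord l1 a"
    by (rule nonneg_bounded_coordwise_convergent_subseq[of p, OF pq(1) pM])
  obtain r2 l2 where 2: "strict_mono r2" "0 \<le> l2"
    "\<forall>a\<in>unit_atoms. (\<lambda>n. coord (q (r1 (r2 n))) a) \<longlonglongrightarrow> coord l2 a"
    by (rule nonneg_bounded_coordwise_convergent_subseq[of "\<lambda>n. q (r1 n)", OF pq(2) qM])
  let ?r = "r1 \<circ> r2"
  have "weakly_tendsto (\<lambda>n. inf \<bar>(x \<circ> ?r) n - (l1 - l2)\<bar> u) 0" if u: "0 \<le> u" for u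
  proof (rule norm_tendsto_imp_weakly_tendsto, rule Lim_null_comparison)
    let ?P = "\<lambda>n. inf \<bar>p (?r n) - l1\<bar> u" and ?Q = "\<lambda>n. inf \<bar>q (?r n) - l2\<bar> u"
    have "(\<lambda>n. coord (p (?r n)) a) \<longlonglongrightarrow> coord l1 a" if "a \<in> unit_atoms" for a
      using LIMSEQ_subseq_LIMSEQ[OF bspec[OF 1(3) that] 2(1)] by (simp add: o_def)
    then have "?P \<longlonglongrightarrow> 0"
      by (intro coordwise_imp_unbounded_norm_convergence pq(1) 1(2) u)
    moreover have "?Q \<longlonglongrightarrow> 0"
      using 2(3) by (intro coordwise_imp_unbounded_norm_convergence pq(2) 2(2) u) simp
    ultimately have "(\<lambda>n. ?P n + ?Q n) \<longlonglongrightarrow> 0 + 0" by (rule tendsto_add)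
    then show "(\<lambda>n. norm (?P n + ?Q n)) \<longlonglongrightarrow> 0" by (simp add: tendsto_norm_zero)
    show "\<forall>\<^sub>F n in sequentially. norm (inf \<bar>(x \<circ> ?r) n - (l1 - l2)\<bar> u) \<le> norm (?P n + ?Q n)"
    proof (rule always_eventually, rule allI)
      fix n
      have "(x \<circ> ?r) n - (l1 - l2) = (p (?r n) - l1) - (q (?r n) - l2)"
        using pq(3)[of "?r n"] by simp
      then have "\<bar>(x \<circ> ?r) n - (l1 - l2)\<bar> \<le> \<bar>p (?r n) - l1\<bar> + \<bar>q (?r n) - l2\<bar>"
        using abs_triangle_ineq4 by metis
      then have "inf \<bar>(x \<circ> ?r) n - (l1 - l2)\<bar> u \<le> inf (\<bar>p (?r n) - l1\<bar> + \<bar>q (?r n) - l2\<bar>) u"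
        by (rule inf_mono) simp
      also have "\<dots> \<le> ?P n + ?Q n" using u by (intro inf_add_le) auto
      finally show "norm (inf \<bar>(x \<circ> ?r) n - (l1 - l2)\<bar> u) \<le> norm (?P n + ?Q n)"
        using u by (intro norm_mono_nonneg) auto
    qed
  qed
  then have "uaw_tendsto (x \<circ> ?r) (l1 - l2)" unfolding uaw_tendsto_def by blast
  moreover have "strict_mono ?r" using 1(1) 2(1) by (rule strict_mono_o)
  ultimately show ?thesis using that by blast
qed

section \<open>Operators and the equivalences\<close>

lemma (in banach_lattice_on) bl_norm_nonneg:
  assumes x: "x \<in> bl_carrier G"
  shows "0 \<le> bl_norm G x"
proof -
  have "bl_minus G x \<in> bl_carrier G" using scale_closed[OF x] by (simp add: bl_minus_def)
  then have "bl_norm G (bl_zero G) \<le> bl_norm G x + bl_norm G (bl_minus G x)"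
    using norm_triangle[OF x] add_minus[OF x] by metis
  then show ?thesis
    using norm_eq_zero[OF zero_closed] norm_scale[OF x, of "-1"] by (simp add: bl_minus_def)
qed

text \<open>A copy of \<open>G\<close> inside another type, with operations pulled back through
  \<open>inv \<iota>\<close>. It places \<open>ell1\<close> among the structures over
  \<open>'g\<close> that assertion (3) ranges over.\<close>

definition image_lattice :: "('a \<Rightarrow> 'b) \<Rightarrow> 'a lattice_structure \<Rightarrow> 'b lattice_structure" where
  "image_lattice \<iota> G = \<lparr>bl_carrier = \<iota> ` bl_carrier G, bl_zero = \<iota> (bl_zero G),
     bl_add = (\<lambda>x y. \<iota> (bl_add G (inv \<iota> x) (inv \<iota> y))), bl_scale = (\<lambda>c x. \<iota> (bl_scale G c (inv \<iota> x))),
     bl_le = (\<lambda>x y. bl_le G (inv \<iota> x) (inv \<iota> y)), bl_norm = (\<lambda>x. bl_norm G (inv \<iota> x))\<rparr>"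

lemma banach_lattice_on_image:
  assumes G: "banach_lattice_on G" and \<iota>: "inj \<iota>"
  shows "banach_lattice_on (image_lattice \<iota> G)"
proof -
  interpret banach_lattice_on G by (rule G)
  let ?H = "image_lattice \<iota> G"
  have inv [simp]: "inv \<iota> (\<iota> x) = x" for x by (rule inv_f_f[OF \<iota>])
  have eq [simp]: "\<iota> x = \<iota> y \<longleftrightarrow> x = y" for x y using \<iota> by (rule inj_eq)
  have mem [simp]: "\<iota> x \<in> \<iota> ` A \<longleftrightarrow> x \<in> A" for x A using \<iota> by (rule inj_image_mem_iff)
  have sel [simp]: "bl_carrier ?H = \<iota> ` bl_carrier G" "bl_zero ?H = \<iota> (bl_zero G)"
    "bl_add ?H (\<iota> x) (\<iota> y) = \<iota> (bl_add G x y)" "bl_scale ?H c (\<iota> x) = \<iota> (bl_scale G c x)"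
    "bl_le ?H (\<iota> x) (\<iota> y) = bl_le G x y" "bl_norm ?H (\<iota> x) = bl_norm G x" for x y c
    by (simp_all add: image_lattice_def)
  have minus [simp]: "bl_minus ?H (\<iota> x) = \<iota> (bl_minus G x)" for x by (simp add: bl_minus_def)
  have sup [simp]: "bl_is_sup ?H (\<iota> x) (\<iota> y) (\<iota> s) = bl_is_sup G x y s"
    and inf [simp]: "bl_is_inf ?H (\<iota> x) (\<iota> y) (\<iota> s) = bl_is_inf G x y s" for x y s
    by (simp_all add: bl_is_sup_def bl_is_inf_def)
  \<comment> \<open>The norm axiom does not list its two absolute values as carrier elements; being
    suprema puts them in the image of \<open>\<iota>\<close>.\<close>
  have supE: "\<exists>s'. s = \<iota> s'" if "bl_is_sup ?H x y s" for x y s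
    using that by (auto simp: bl_is_sup_def)
  show ?thesis
  proof (unfold_locales, goal_cases)
    case (5 x y)
    then obtain x' y' where "x = \<iota> x'" "y = \<iota> y'" "x' \<in> bl_carrier G" "y' \<in> bl_carrier G" by auto
    then show ?case using add_commute[of x' y'] by simp
  next
    case (13 x y)
    then obtain x' y' where "x = \<iota> x'" "y = \<iota> y'" "x' \<in> bl_carrier G" "y' \<in> bl_carrier G" by auto
    with 13(3,4) show ?case using le_antisym[of x' y'] by simp
  next
    case (15 x y)
    then obtain x' y' where "x = \<iota> x'" "y = \<iota> y'" "x' \<in> bl_carrier G" "y' \<in> bl_carrier G" by auto
    then show ?case using sup_exists[of x' y'] sup by blast
  next
    case (16 x y)
    then obtain x' y' where "x = \<iota> x'" "y = \<iota> y'" "x' \<in> bl_carrier G" "y' \<in> bl_carrier G" by auto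
    then show ?case using inf_exists[of x' y'] inf by blast
  next
    case (14 x y z)
    then obtain x' y' z' where "x = \<iota> x'" "y = \<iota> y'" "z = \<iota> z'"
      "x' \<in> bl_carrier G" "y' \<in> bl_carrier G" "z' \<in> bl_carrier G" by auto
    with 14(4,5) show ?case using le_trans[of x' y' z'] by simp
  next
    case (22 x y a b)
    then obtain x' y' where xy: "x = \<iota> x'" "y = \<iota> y'" "x' \<in> bl_carrier G" "y' \<in> bl_carrier G" by auto
    obtain a' b' where ab: "a = \<iota> a'" "b = \<iota> b'" using supE[OF 22(3)] supE[OF 22(4)] by blast
    show ?case using 22(3-5) xy ab norm_mono_abs[of x' y' a' b'] by simp
  next
    case (23 u)
    have "u n \<in> \<iota> ` bl_carrier G" for n using 23(1)[of n] by simp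
    then have "\<forall>n. \<exists>v. v \<in> bl_carrier G \<and> u n = \<iota> v" by blast
    then obtain v where v: "\<And>n. v n \<in> bl_carrier G" "\<And>n. u n = \<iota> (v n)" by metis
    have "\<exists>N. \<forall>m\<ge>N. \<forall>n\<ge>N. bl_norm G (bl_add G (v m) (bl_minus G (v n))) < e" if "0 < e" for e
      using 23(2)[OF that] by (simp add: v(2))
    from norm_complete[OF v(1) this] obtain l where "l \<in> bl_carrier G"
      "(\<lambda>n. bl_norm G (bl_add G (v n) (bl_minus G l))) \<longlonglongrightarrow> 0" by blast
    then show ?case by (intro bexI[of _ "\<iota> l"]) (simp_all add: v(2))
  qed (auto simp: zero_closed add_closed scale_closed add_assoc add_zero add_minus scale_add_right
      scale_add_left scale_scale scale_one le_refl add_mono scale_mono norm_eq_zero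
      norm_triangle norm_scale)
qed

lemma bounded_linear_from_image:
  assumes "bounded_linear_from G S" "inj \<iota>"
  shows "bounded_linear_from (image_lattice \<iota> G) (S \<circ> inv \<iota>)"
  using assms unfolding bounded_linear_from_def image_lattice_def by simp

lemma compact_from_image:
  assumes "inj \<iota>"
  shows "compact_from (image_lattice \<iota> G) (R \<circ> inv \<iota>) \<longleftrightarrow> compact_from G R"
proof -
  have "(R \<circ> inv \<iota>) ` {x \<in> \<iota> ` bl_carrier G. bl_norm G (inv \<iota> x) \<le> 1}
      = R ` {x \<in> bl_carrier G. bl_norm G x \<le> 1}"
    using assms by (force simp: image_iff)
  then show ?thesis by (simp add: compact_from_def image_lattice_def)
qed

section \<open>Operators defined on \<open>ell1\<close>\<close>

lemma ell1_operator:
  fixes x :: "nat \<Rightarrow> 'y::banach"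
  assumes "bounded (range x)"
  shows "bounded_linear_from ell1 (\<lambda>c. \<Sum>i. c i *\<^sub>R x i)"
proof -
  obtain M where M: "\<And>n. norm (x n) \<le> M" using assms by (auto simp: bounded_iff)
  \<comment> \<open>Boundedness of the sequence makes the series absolutely convergent, with
    \<open>M\<close> as operator bound.\<close>
  have le: "norm (c i *\<^sub>R x i) \<le> M * \<bar>c i\<bar>" for c i
    using mult_left_mono[OF M[of i] abs_ge_zero[of "c i"]] by (simp add: mult.commute)
  have sn: "summable (\<lambda>i. norm (c i *\<^sub>R x i))" if "summable (\<lambda>i. \<bar>c i\<bar>)" for c
    by (rule summable_comparison_test'[OF summable_mult[OF that, of M], of 0]) (use le in auto)
  have s: "summable (\<lambda>i. c i *\<^sub>R x i)" if "summable (\<lambda>i. \<bar>c i\<bar>)" for c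
    using sn[OF that] by (rule summable_norm_cancel)
  have "norm (\<Sum>i. c i *\<^sub>R x i) \<le> M * (\<Sum>i. \<bar>c i\<bar>)" if c: "summable (\<lambda>i. \<bar>c i\<bar>)" for c
  proof -
    have "norm (\<Sum>i. c i *\<^sub>R x i) \<le> (\<Sum>i. norm (c i *\<^sub>R x i))" by (rule summable_norm[OF sn[OF c]])
    also have "\<dots> \<le> (\<Sum>i. M * \<bar>c i\<bar>)" by (intro suminf_le le sn[OF c] summable_mult[OF c])
    finally show ?thesis by (simp add: suminf_mult[OF c])
  qed
  then have "\<exists>K. \<forall>c. summable (\<lambda>i. \<bar>c i\<bar>) \<longrightarrow> norm (\<Sum>i. c i *\<^sub>R x i) \<le> K * (\<Sum>i. \<bar>c i\<bar>)"
    by blast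
  moreover have "(\<Sum>i. (c i + d i) *\<^sub>R x i) = (\<Sum>i. c i *\<^sub>R x i) + (\<Sum>i. d i *\<^sub>R x i)"
    if "summable (\<lambda>i. \<bar>c i\<bar>)" "summable (\<lambda>i. \<bar>d i\<bar>)" for c d
    using suminf_add[OF s[OF that(1)] s[OF that(2)]] by (simp add: scaleR_add_left)
  moreover have "(\<Sum>i. (t * c i) *\<^sub>R x i) = t *\<^sub>R (\<Sum>i. c i *\<^sub>R x i)"
    if "summable (\<lambda>i. \<bar>c i\<bar>)" for c t
    using suminf_scaleR_right[OF s[OF that], of t] by simp
  ultimately show ?thesis by (simp add: bounded_linear_from_def ell1_def)
qed

text \<open>The operator given by the series with terms \<open>c i *\<^sub>R x i\<close> sends the
  \<open>n\<close>-th unit vector, which lies in the unit ball, to \<open>x n\<close>; the closed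
  image of the ball under the composition serves as \<open>K\<close>.\<close>

lemma ell1_compact_imp_relatively_compact:
  fixes x :: "nat \<Rightarrow> 'e::banach"
  assumes "bounded (range x)"
    and compact: "\<And>S. bounded_linear_from ell1 S \<Longrightarrow> compact_from ell1 (T \<circ> S)"
  shows "\<exists>K. compact K \<and> (\<forall>n. T (x n) \<in> K)"
proof -
  let ?S = "\<lambda>c. \<Sum>i. c i *\<^sub>R x i"
  let ?B = "{c \<in> bl_carrier ell1. bl_norm ell1 c \<le> 1}"
  have "T (x n) \<in> closure ((T \<circ> ?S) ` ?B)" for n
  proof -
    let ?\<delta> = "\<lambda>i. if i = n then 1 else 0 :: real"
    have "(\<lambda>i. if i = n then x n else 0) sums x n" by (rule sums_single)
    moreover have "(\<lambda>i. if i = n then x n else 0) = (\<lambda>i. ?\<delta> i *\<^sub>R x i)" by auto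
    ultimately have "?S ?\<delta> = x n" by (simp add: sums_iff)
    moreover have "(\<lambda>i. \<bar>?\<delta> i\<bar>) = ?\<delta>" by auto
    then have "(\<lambda>i. \<bar>?\<delta> i\<bar>) sums 1" using sums_single[of n "\<lambda>_. 1 :: real"] by simp
    then have "?\<delta> \<in> ?B" by (simp add: ell1_def sums_iff)
    ultimately have "T (x n) \<in> (T \<circ> ?S) ` ?B" by (intro image_eqI[of _ _ ?\<delta>]) auto
    then show ?thesis by (rule subsetD[OF closure_subset])
  qed
  moreover have "compact (closure ((T \<circ> ?S) ` ?B))"
    using compact[OF ell1_operator[OF assms(1)]] by (simp add: compact_from_def)
  ultimately show ?thesis by blast
qed

text \<open>A sequence in the range has the form \<open>x (k n)\<close>. Either some index recurs
  infinitely often, giving a constant subsequence, or \<open>k\<close> tends to infinity and the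
  whole sequence is uaw-null.\<close>

lemma uaw_null_range_relatively_sigma_uaw_compact:
  fixes x :: "nat \<Rightarrow> 'a::banach_lattice"
  assumes "bounded (range x)" "uaw_tendsto x 0"
  shows "relatively_sigma_uaw_compact (range x)"
  unfolding relatively_sigma_uaw_compact_def
proof (intro conjI allI impI assms(1))
  fix y :: "nat \<Rightarrow> 'a" assume "\<forall>n. y n \<in> range x"
  then have "\<forall>n. \<exists>k. y n = x k" by blast
  then obtain k where k: "\<And>n. y n = x (k n)" by metis
  show "\<exists>r l. strict_mono r \<and> uaw_tendsto (y \<circ> r) l"
  proof (cases "\<exists>m. infinite {n. k n = m}")
    case True
    then obtain m where "infinite {n. k n = m}" ..
    then obtain r :: "nat \<Rightarrow> nat" where r: "strict_mono r" "\<forall>n. r n \<in> {n. k n = m}"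
      using infinite_enumerate[of "{n. k n = m}"] by blast
    then have "uaw_tendsto (y \<circ> r) (x m)"
      by (simp add: uaw_tendsto_def weakly_tendsto_def k inf_absorb1)
    with r(1) show ?thesis by blast
  next
    case False
    have k_lim: "filterlim k at_top sequentially"
      unfolding filterlim_at_top
    proof
      fix N
      \<comment> \<open>Each value is attained only finitely often, so only finitely many
        \<open>n\<close> have \<open>k n < N\<close>.\<close>
      have "{n. \<not> N \<le> k n} = (\<Union>m<N. {n. k n = m})" by auto
      also have "finite \<dots>" using False by auto
      finally show "\<forall>\<^sub>F n in sequentially. N \<le> k n"
        by (simp add: eventually_cofinite flip: cofinite_eq_sequentially)
    qed
    have "uaw_tendsto (y \<circ> id) 0"
      unfolding uaw_tendsto_def weakly_tendsto_def
    proof (intro allI impI)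
      fix u :: 'a and f :: "'a \<Rightarrow> real" assume "0 \<le> u" "bounded_linear f"
      then have "(\<lambda>n. f (inf \<bar>x n - 0\<bar> u)) \<longlonglongrightarrow> f 0"
        using assms(2) by (simp add: uaw_tendsto_def weakly_tendsto_def)
      from filterlim_compose[OF this k_lim]
      show "(\<lambda>n. f (inf \<bar>(y \<circ> id) n - 0\<bar> u)) \<longlonglongrightarrow> f 0" by (simp add: k)
    qed
    moreover have "strict_mono (id :: nat \<Rightarrow> nat)" by (simp add: strict_mono_def)
    ultimately show ?thesis by blast
  qed
qed

text \<open>Translation by \<open>l\<close> reduces this to null sequences, since uaw-convergence
  depends only on \<open>x n - l\<close>.\<close>

lemma uaw_Dunford_Pettis_tendsto:
  assumes T: "bounded_linear T" "uaw_Dunford_Pettis T" and x: "bounded (range x)" "uaw_tendsto x l"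
  shows "(\<lambda>n. T (x n)) \<longlonglongrightarrow> T l"
proof -
  have "bounded (range (\<lambda>n. x n - l))"
    using bounded_translation[OF x(1), of "- l"] by (simp add: image_image)
  moreover have "uaw_tendsto (\<lambda>n. x n - l) 0" using x(2) by (simp add: uaw_tendsto_def)
  ultimately have "(\<lambda>n. norm (T (x n - l))) \<longlonglongrightarrow> 0"
    using T(2) unfolding uaw_Dunford_Pettis_def by blast
  then have "(\<lambda>n. T (x n) - T l) \<longlonglongrightarrow> 0"
    by (simp add: linear_diff[OF bounded_linear.linear[OF T(1)]] tendsto_norm_zero_iff)
  then show ?thesis by (rule LIM_zero_cancel)
qed

text \<open>Common end of the implications from (2) and (4) to (1): each supplies \<open>K\<close>,
  and unbounded continuity supplies weak convergence to 0.\<close>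

lemma uaw_Dunford_PettisI_relatively_compact:
  fixes T :: "'e::banach_lattice \<Rightarrow> 'y::real_normed_vector"
  assumes "unbounded_continuous T"
    and "\<And>x. bounded (range x) \<Longrightarrow> uaw_tendsto x 0 \<Longrightarrow> \<exists>K. compact K \<and> (\<forall>n. T (x n) \<in> K)"
  shows "uaw_Dunford_Pettis T"
  unfolding uaw_Dunford_Pettis_def
proof (intro allI impI)
  fix x :: "nat \<Rightarrow> 'e" assume x: "bounded (range x) \<and> uaw_tendsto x 0"
  then obtain K where "compact K" "\<And>n. T (x n) \<in> K" using assms(2) by blast
  moreover have "weakly_tendsto (\<lambda>n. T (x n)) 0"
    using assms(1) x unfolding unbounded_continuous_def by blast
  ultimately have "(\<lambda>n. T (x n)) \<longlonglongrightarrow> 0" by (intro weakly_null_in_compact_imp_null)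
  then show "(\<lambda>n. norm (T (x n))) \<longlonglongrightarrow> 0" by (rule tendsto_norm_zero)
qed

theorem theorem3p1:
  fixes T :: "'e::{kb_space, atomic_banach_lattice} \<Rightarrow> 'y::banach"
    and \<iota> :: "(nat \<Rightarrow> real) \<Rightarrow> 'g"
  assumes "bounded_linear T"
    and "unbounded_continuous T"
    and "inj \<iota>"
  shows "(uaw_Dunford_Pettis T \<longleftrightarrow>
           (\<forall>A. relatively_sigma_uaw_compact A \<longrightarrow> totally_bounded (T ` A))) \<and>
         (uaw_Dunford_Pettis T \<longleftrightarrow>
           (\<forall>(G :: 'g lattice_structure) S. banach_lattice_on G \<and> bounded_linear_from G S \<longrightarrow>
             compact_from G (T \<circ> S))) \<and>
         (uaw_Dunford_Pettis T \<longleftrightarrow>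
           (\<forall>S. bounded_linear_from ell1 S \<longrightarrow> compact_from ell1 (T \<circ> S)))"
    (is "(?one \<longleftrightarrow> ?two) \<and> (?one \<longleftrightarrow> ?three) \<and> (?one \<longleftrightarrow> ?four)")
proof -
  \<comment> \<open>The scheme is (1) to (2) and back, then the cycle (1) to (3) to (4) to
    (1).\<close>
  have "?two" if ?one
  proof (intro allI impI)
    fix A :: "'e set" assume A: "relatively_sigma_uaw_compact A"
    have "compact (closure (T ` A))"
    proof (rule compact_closureI_subseq)
      fix y :: "nat \<Rightarrow> 'y" assume "\<And>n. y n \<in> T ` A"
      then have "\<forall>n. \<exists>a. a \<in> A \<and> y n = T a" by blast
      then obtain a where a: "\<And>n. a n \<in> A" "\<And>n. y n = T (a n)" by metis
      obtain r l where r: "strict_mono r" "uaw_tendsto (a \<circ> r) l"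
        using A a(1) unfolding relatively_sigma_uaw_compact_def by blast
      have "bounded (range (a \<circ> r))"
        by (rule bounded_subset[of A])
          (use A a(1) in \<open>auto simp: relatively_sigma_uaw_compact_def\<close>)
      then have "(\<lambda>n. T ((a \<circ> r) n)) \<longlonglongrightarrow> T l"
        using r(2) by (rule uaw_Dunford_Pettis_tendsto[OF assms(1) \<open>?one\<close>])
      then have "(y \<circ> r) \<longlonglongrightarrow> T l" by (simp add: a(2) o_def)
      with r(1) show "\<exists>r l. strict_mono r \<and> (y \<circ> r) \<longlonglongrightarrow> l" by blast
    qed
    then show "totally_bounded (T ` A)" by (simp add: totally_bounded_iff_compact_closure)
  qed
  moreover have ?one if ?two
  proof (rule uaw_Dunford_PettisI_relatively_compact[OF assms(2)])
    fix x :: "nat \<Rightarrow> 'e" assume "bounded (range x)" "uaw_tendsto x 0"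
    then have "totally_bounded (T ` range x)"
      using \<open>?two\<close> uaw_null_range_relatively_sigma_uaw_compact by blast
    then have "compact (closure (T ` range x))" by (simp add: totally_bounded_iff_compact_closure)
    moreover have "\<forall>n. T (x n) \<in> closure (T ` range x)"
      using closure_subset[of "T ` range x"] by blast
    ultimately show "\<exists>K. compact K \<and> (\<forall>n. T (x n) \<in> K)" by blast
  qed
  moreover have ?three if ?one
  proof (intro allI impI)
    fix G :: "'g lattice_structure" and S :: "'g \<Rightarrow> 'e"
    assume "banach_lattice_on G \<and> bounded_linear_from G S"
    then have G: "banach_lattice_on G" and S: "bounded_linear_from G S" by auto
    from S obtain K where K: "\<And>x. x \<in> bl_carrier G \<Longrightarrow> norm (S x) \<le> K * bl_norm G x"
      unfolding bounded_linear_from_def by blast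
    show "compact_from G (T \<circ> S)"
      unfolding compact_from_def
    proof (rule compact_closureI_subseq)
      fix y :: "nat \<Rightarrow> 'y"
      assume "\<And>n. y n \<in> (T \<circ> S) ` {x \<in> bl_carrier G. bl_norm G x \<le> 1}"
      then have "\<forall>n. \<exists>g. g \<in> bl_carrier G \<and> bl_norm G g \<le> 1 \<and> y n = T (S g)" by force
      then obtain g where g: "\<And>n. g n \<in> bl_carrier G" "\<And>n. bl_norm G (g n) \<le> 1"
        "\<And>n. y n = T (S (g n))" by metis
      define x where "x n = S (g n)" for n
      \<comment> \<open>The bound \<open>K\<close> may be negative, hence the absolute value;
        nonnegativity of \<open>bl_norm\<close> justifies the product estimate.\<close>
      have "norm (x n) \<le> \<bar>K\<bar>" for n
      proof -
        have "norm (x n) \<le> K * bl_norm G (g n)" using K[OF g(1)] by (simp add: x_def)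
        also have "\<dots> \<le> \<bar>K\<bar> * 1"
          using banach_lattice_on.bl_norm_nonneg[OF G g(1)] g(2) by (intro mult_mono) auto
        finally show ?thesis by simp
      qed
      then have b: "bounded (range x)" by (auto simp: bounded_iff)
      obtain r l where r: "strict_mono r" "uaw_tendsto (x \<circ> r) l"
        using bounded_uaw_convergent_subseq[OF b] by blast
      have "bounded (range (x \<circ> r))" by (rule bounded_subset[OF b]) auto
      then have "(\<lambda>n. T ((x \<circ> r) n)) \<longlonglongrightarrow> T l"
        using r(2) by (rule uaw_Dunford_Pettis_tendsto[OF assms(1) \<open>?one\<close>])
      then have "(y \<circ> r) \<longlonglongrightarrow> T l" by (simp add: g(3) x_def o_def)
      with r(1) show "\<exists>r l. strict_mono r \<and> (y \<circ> r) \<longlonglongrightarrow> l" by blast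
    qed
  qed
  moreover have ?four if ?three
  proof (intro allI impI)
    fix S :: "(nat \<Rightarrow> real) \<Rightarrow> 'e" assume "bounded_linear_from ell1 S"
    \<comment> \<open>Assertion (3) is applied to the copy of \<open>ell1\<close> over
      \<open>'g\<close>, and compactness is carried back because both unit balls have the same
      image.\<close>
    then have "compact_from (image_lattice \<iota> ell1) (T \<circ> (S \<circ> inv \<iota>))"
      using \<open>?three\<close> banach_lattice_on_image[OF banach_lattice_on_ell1 assms(3)]
        bounded_linear_from_image[OF _ assms(3)] by blast
    then show "compact_from ell1 (T \<circ> S)"
      using compact_from_image[OF assms(3), of ell1 "T \<circ> S"] by (simp add: o_assoc)
  qed
  moreover have ?one if ?four
    using assms(2)
  proof (rule uaw_Dunford_PettisI_relatively_compact)
    fix x :: "nat \<Rightarrow> 'e" assume "bounded (range x)"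
    then show "\<exists>K. compact K \<and> (\<forall>n. T (x n) \<in> K)"
      by (rule ell1_compact_imp_relatively_compact) (use \<open>?four\<close> in blast)
  qed
  ultimately show ?thesis by argo
qed

end
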